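(* Let $q\in L_1[0,1]$ be complex-valued with $q(x+1)=q(x)$ and $q_n=0$ for all $n=0,-1,-2,\dots$. Let $n\in\mathbb N$. (a) Let $\Psi$ be a solution of $L_0(q)\Psi=(2\pi n)^2\Psi$. If $(\Psi,e^{-i2\pi nx})\neq0$, then $\Psi$ has, up to a constant factor, the form $$e^{-i2\pi nx}+\sum_{p\in\mathbb N}c_p\,e^{i2\pi(-n+p)x}.\qquad(\ast)$$ If $(\Psi,e^{-i2\pi nx})=0$ and $(\Psi,e^{i2\pi nx})\neq0$, then $\Psi$ has, up to a constant factor, the form $$e^{i2\pi nx}+\sum_{p\in\mathbb N}d_p\,e^{i2\pi(n+p)x}.\qquad(\ast\ast)$$ If both $(\Psi,e^{-i2\pi nx})$ and $(\Psi,e^{i2\pi nx})$ are zero, then $\Psi$ is the zero function. (Here $c_p,d_p$ are complex numbers.) (b) If the geometric multiplicity of the eigenvalue $(2\pi n)^2$ of $L_0(q)$ is two, then there exist linearly independent eigenfunctions $\Psi_{-n}$ and $\Psi_n$ corresponding to it, having the forms $(\ast)$ and $(\ast\ast)$ respectively. (c) If the geometric multiplicity of the eigenvalue $(2\pi n)^2$ of $L_0(q)$ is one, then the operator $L_0(q)$ has an eigenfunction $\Psi$ of the form $(\ast\ast)$ and an associated function $\Phi$ of the form $(\ast)$ corresponding to the eigenfunction $c\Psi$, where $c$ is a nonzero constant; that is, $(L_0(q)-(2\pi n)^2I)\Phi=c\Psi$.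
   Context: $(\cdot,\cdot)$ is the inner product of $L_2[0,1]$ (also used for $q\in L_1[0,1]$ against bounded functions), $q_n=(q,e^{i2\pi nx})=\int_0^1q(x)e^{-i2\pi nx}dx$, $\mathbb N=\{1,2,\dots\}$. $L_0(q)$ is the operator generated in $L_2[0,1]$ by $-y''+qy$ and the periodic boundary conditions $y(1)=y(0)$, $y'(1)=y'(0)$. Under the stated conditions on $q$, it is known that $(2\pi n)^2$ for $n\neq0$ is a double eigenvalue of $L_0(q)$ (counted with algebraic multiplicity). *)

theory Defs
  imports "HOL-Analysis.Analysis" "HOL-Library.Function_Algebras"
begin

definition ip01 :: "(real \<Rightarrow> complex) \<Rightarrow> (real \<Rightarrow> complex) \<Rightarrow> complex" where
  "ip01 f g = (LINT x:{0..1}|lebesgue. f x * cnj (g x))"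

definition expi :: "int \<Rightarrow> real \<Rightarrow> complex" where
  "expi k x = exp (\<i> * complex_of_real (2 * pi * real_of_int k * x))"

definition L2_01 :: "(real \<Rightarrow> complex) set" where
  "L2_01 = {f. f \<in> borel_measurable (lebesgue_on {0..1}) \<and>
               integrable (lebesgue_on {0..1}) (\<lambda>x. (norm (f x))\<^sup>2)}"

text \<open>Absolute continuity on $[0,1]$ in the form of an indefinite Lebesgue integral:
  \<open>F\<close> is absolutely continuous and \<open>f\<close> is its almost-everywhere derivative.\<close>

definition has_ac_derivative :: "(real \<Rightarrow> complex) \<Rightarrow> (real \<Rightarrow> complex) \<Rightarrow> bool" where
  "has_ac_derivative F f \<longleftrightarrow>
     f absolutely_integrable_on {0..1} \<and>
     (\<forall>x\<in>{0..1}. F x = F 0 + (LINT t:{0..x}|lebesgue. f t))"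

text \<open>The graph of the operator generated in $L_2[0,1]$ by $-y''+qy$ and the periodic boundary
  conditions: \<open>L0 q y z\<close> says that \<open>y\<close> belongs to the domain ($y'$ exists and is absolutely
  continuous on $[0,1]$, the boundary conditions hold, and $-y''+qy \in L_2[0,1]$) and that \<open>z\<close>
  represents the image of \<open>y\<close>. An element of the domain is represented by its continuous version
  on $[0,1]$, extended by \<open>0\<close> to the whole line. Thus distinct functions \<open>y\<close> are distinct elements of
  $L_2[0,1]$ and dimensions of eigenspaces are dimensions of spaces of such functions;
  \<open>z\<close> matters only up to null sets in $[0,1]$.\<close>

definition L0 :: "(real \<Rightarrow> complex) \<Rightarrow> (real \<Rightarrow> complex) \<Rightarrow> (real \<Rightarrow> complex) \<Rightarrow> bool" where
  "L0 q y z \<longleftrightarrow>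
     (\<forall>x. x \<notin> {0..1} \<longrightarrow> y x = 0) \<and>
     (\<exists>y' y''.
        (\<forall>x\<in>{0..1}. (y has_vector_derivative y' x) (at x within {0..1})) \<and>
        has_ac_derivative y' y'' \<and>
        y 1 = y 0 \<and> y' 1 = y' 0 \<and>
        z \<in> L2_01 \<and>
        (AE x in lebesgue_on {0..1}. z x = - y'' x + q x * y x))"

definition eigenspace :: "(real \<Rightarrow> complex) \<Rightarrow> complex \<Rightarrow> (real \<Rightarrow> complex) set" where
  "eigenspace q l = {y. L0 q y (\<lambda>x. l * y x)}"

definition eigenfunction ::
  "(real \<Rightarrow> complex) \<Rightarrow> complex \<Rightarrow> (real \<Rightarrow> complex) \<Rightarrow> bool" where
  "eigenfunction q l y \<longleftrightarrow> y \<in> eigenspace q l \<and> y \<noteq> (\<lambda>x. 0)"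

text \<open>\<open>u\<close> is an associated function corresponding to the eigenfunction \<open>y\<close>: $(L_0(q) - l I)u = y$.\<close>

definition associated_function ::
  "(real \<Rightarrow> complex) \<Rightarrow> complex \<Rightarrow> (real \<Rightarrow> complex) \<Rightarrow> (real \<Rightarrow> complex) \<Rightarrow> bool" where
  "associated_function q l y u \<longleftrightarrow>
     eigenfunction q l y \<and>
     (\<exists>z. L0 q u z \<and> (AE x in lebesgue_on {0..1}. z x - l * u x = y x))"

global_interpretation cfun: vector_space "\<lambda>(c::complex) (f::real \<Rightarrow> complex) x. c * f x"
  by unfold_locales (simp_all add: fun_eq_iff algebra_simps)

definition geometric_multiplicity :: "(real \<Rightarrow> complex) \<Rightarrow> complex \<Rightarrow> nat" where
  "geometric_multiplicity q l = cfun.dim (eigenspace q l)"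

text \<open>$F(x) = e^{i2\pi mx} + \sum_{p\ge 1} c_p e^{i2\pi(m+p)x}$ on $[0,1]$, the series converging
  uniformly (hence also pointwise and in $L_2[0,1]$).\<close>

definition has_form :: "int \<Rightarrow> (real \<Rightarrow> complex) \<Rightarrow> bool" where
  "has_form m F \<longleftrightarrow>
     (\<exists>c :: nat \<Rightarrow> complex.
        uniform_limit {0..1} (\<lambda>N x. expi m x + (\<Sum>p=1..N. c p * expi (m + int p) x))
          F sequentially)"

definition has_form_up_to_constant :: "int \<Rightarrow> (real \<Rightarrow> complex) \<Rightarrow> bool" where
  "has_form_up_to_constant m F \<longleftrightarrow>
     (\<exists>a G. a \<noteq> 0 \<and> has_form m G \<and> (\<forall>x\<in>{0..1}. F x = a * G x))"

end

theory Submission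
  imports Defs
begin

text \<open>
  In Fourier coefficients \<open>y\<^sub>k\<close> the equation \<open>(L0 q - (2 \<pi> n)\<^sup>2) y = f\<close> reads
  \<open>(2 \<pi>)\<^sup>2 (k\<^sup>2 - n\<^sup>2) y\<^sub>k + (\<Sum>j<k. q\<^sub>k\<^sub>-\<^sub>j y\<^sub>j) = f\<^sub>k\<close>. The sum runs over \<open>j < k\<close> only, because
  \<open>q\<close> has no coefficients of index at most zero. This system is triangular, with a diagonal that
  vanishes exactly at the two resonances \<open>k = \<plusminus>n\<close>, and everything follows from solving it upward in \<open>k\<close>.

  Passing between functions and coefficients needs three tools: integration by parts for absolutely continuous
  functions (\<open>integration_by_parts_ac\<close>), uniqueness of Fourier coefficients
  (\<open>fourier_uniqueness\<close>), and the convolution formula for the coefficients of a product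
  (\<open>fourier_coefficients_product\<close>). They yield \<open>eigenspace_recurrence\<close> in one direction and
  \<open>L0_trig_series\<close> in the other.

  Uniqueness: for \<open>k < -n\<close> the recurrence bounds \<open>y\<^sub>k\<close> by \<open>O((\<bar>k\<bar> - n)\<^sup>-\<^sup>2)\<close> times the tail
  \<open>\<Sum>j<k. \<bar>y\<^sub>j\<bar>\<close>. As these factors are summable, a Gronwall argument started at minus infinity forces all
  these coefficients to vanish (\<open>eigenfunction_coeff_below\<close>). Going upward from there, nonzero
  coefficients can first appear only at a resonance. This is part (a), and it shows that an eigenfunction is
  determined by its coefficients at \<open>-n\<close> and \<open>n\<close>.

  Existence: forward substitution produces absolutely summable solutions, again by a Gronwall
  estimate (\<open>recurrence_solution\<close>). Started at \<open>n\<close> it gives an eigenfunction \<open>\<Psi>\<close> with lowest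
  frequency \<open>n\<close>. Started at \<open>-n\<close> it must cross the resonance at \<open>n\<close>, where the equation holds up to a
  constant \<open>c\<close>; after a correction above \<open>n\<close> one gets \<open>\<Phi>\<close> with lowest frequency \<open>-n\<close> and
  \<open>(L0 q - (2 \<pi> n)\<^sup>2) \<Phi> = c \<Psi>\<close> (\<open>lower_chain_coefficients\<close>). If the geometric multiplicity is one,
  \<open>c = 0\<close> is impossible because \<open>\<Phi>\<close> would be a second independent eigenfunction; this is part (c). If it is
  two, not every eigenfunction is a multiple of \<open>\<Psi>\<close>, so some eigenfunction has a nonzero coefficient at
  \<open>-n\<close>, and part (b) follows from part (a).
\<close>

section \<open>Integrals over the unit interval\<close>

abbreviation I01 :: "real measure" where
  "I01 \<equiv> lebesgue_on {0..1}"

lemma absolutely_integrable_01_iff: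
  fixes f :: "real \<Rightarrow> complex"
  shows "f absolutely_integrable_on {0..1} \<longleftrightarrow> integrable I01 f"
  by (simp add: set_integrable_def integrable_restrict_space)

lemma ip01_eq: "ip01 f g = (\<integral>x. f x * cnj (g x) \<partial>I01)"
  by (simp add: ip01_def set_lebesgue_integral_def integral_restrict_space)

lemma set_integral_01_eq:
  fixes f :: "real \<Rightarrow> complex"
  assumes "x \<in> {0..1}"
  shows "(LINT t:{0..x}|lebesgue. f t) = (\<integral>t. indicator {0..x} t *\<^sub>R f t \<partial>I01)"
proof -
  have "indicat_real {0..1} t *\<^sub>R indicat_real {0..x} t *\<^sub>R f t = indicat_real {0..x} t *\<^sub>R f t" for t
    using assms by (auto simp: indicator_def)
  then show ?thesis
    by (simp add: set_lebesgue_integral_def integral_restrict_space del: scaleR_scaleR)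
qed

lemma continuous_on_01_bounded:
  fixes g :: "real \<Rightarrow> complex"
  assumes "continuous_on {0..1} g"
  obtains B where "B > 0" "\<And>x. x \<in> {0..1} \<Longrightarrow> norm (g x) \<le> B"
proof -
  have "bounded (g ` {0..1})"
    using assms compact_continuous_image compact_imp_bounded by blast
  then show ?thesis
    using that by (auto simp: bounded_pos)
qed

lemma measurable_01_continuous:
  fixes g :: "real \<Rightarrow> complex"
  assumes "continuous_on {0..1} g"
  shows "g \<in> borel_measurable I01"
  using assms by (intro continuous_imp_measurable_on_sets_lebesgue) auto

lemma integrable_mult_continuous:
  fixes f g :: "real \<Rightarrow> complex"
  assumes f: "integrable I01 f" and g: "continuous_on {0..1} g"
  shows "integrable I01 (\<lambda>x. f x * g x)"
proof -
  obtain B where B: "\<And>x. x \<in> {0..1} \<Longrightarrow> norm (g x) \<le> B" "B > 0"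
    using continuous_on_01_bounded[OF g] by metis
  have m: "f \<in> borel_measurable I01" "g \<in> borel_measurable I01"
    using f measurable_01_continuous[OF g] by auto
  show ?thesis
  proof (rule Bochner_Integration.integrable_bound)
    show "integrable I01 (\<lambda>x. B * norm (f x))"
      using f by simp
    show "(\<lambda>x. f x * g x) \<in> borel_measurable I01"
      using m by simp
    show "AE x in I01. norm (f x * g x) \<le> norm (B * norm (f x))"
      using B by (intro AE_I2) (auto simp: norm_mult mult.commute[of B] intro!: mult_left_mono)
  qed
qed

lemma integrable_01_const [simp]: "integrable I01 (\<lambda>x. c :: complex)"
proof -
  interpret finite_measure I01 by (rule finite_measure_lebesgue_on) simp
  show ?thesis by simp
qed

lemma integrable_01_continuous:
  fixes g :: "real \<Rightarrow> complex"
  assumes "continuous_on {0..1} g"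
  shows "integrable I01 g"
  using integrable_mult_continuous[OF integrable_01_const assms, of 1] by simp

lemma continuous_imp_L2_01:
  assumes "continuous_on {0..1} f"
  shows "f \<in> L2_01"
proof -
  have "integrable I01 (\<lambda>x. f x * cnj (f x))"
    using assms by (intro integrable_mult_continuous integrable_01_continuous continuous_intros)
  then have "integrable I01 (\<lambda>x. norm (f x * cnj (f x)))"
    by (rule integrable_norm)
  then show ?thesis
    using measurable_01_continuous[OF assms]
    by (simp add: L2_01_def norm_mult power2_eq_square)
qed

lemma integral_01_eq_integral:
  fixes g :: "real \<Rightarrow> complex"
  assumes "continuous_on {a..b} g" "0 \<le> a" "a \<le> b" "b \<le> 1"
  shows "(\<integral>t. indicator {a..b} t *\<^sub>R g t \<partial>I01) = integral {a..b} g"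
proof -
  have "indicat_real {0..1} t *\<^sub>R indicat_real {a..b} t *\<^sub>R g t = indicat_real {a..b} t *\<^sub>R g t" for t
    using assms by (auto simp: indicator_def)
  then have "(\<integral>t. indicator {a..b} t *\<^sub>R g t \<partial>I01) = (LINT t:{a..b}|lebesgue. g t)"
    by (simp add: set_lebesgue_integral_def integral_restrict_space del: scaleR_scaleR)
  also have "\<dots> = integral {a..b} g"
    using assms by (intro set_lebesgue_integral_eq_integral absolutely_integrable_continuous_real)
  finally show ?thesis .
qed

section \<open>Exponentials\<close>

lemma expi_add: "expi (j + k) x = expi j x * expi k x"
  by (simp add: expi_def exp_add[symmetric] algebra_simps)

lemma expi_0 [simp]: "expi 0 x = 1"
  by (simp add: expi_def)

lemma expi_at_0 [simp]: "expi k 0 = 1"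
  by (simp add: expi_def)

lemma expi_at_1 [simp]: "expi k 1 = 1"
  by (simp add: expi_def exp_eq_1 mult_ac)

lemma norm_expi [simp]: "norm (expi k x) = 1"
  unfolding expi_def by (subst norm_exp_eq_Re) simp

lemma cnj_expi: "cnj (expi k x) = expi (- k) x"
  by (simp add: expi_def exp_cnj)

lemma continuous_on_expi [continuous_intros]: "continuous_on A (expi k)"
  unfolding expi_def by (intro continuous_intros)

lemma expi_has_vector_derivative:
  "(expi k has_vector_derivative 2 * pi * \<i> * of_int k * expi k x) (at x within A)"
proof -
  have "((\<lambda>z. exp (\<i> * (2 * pi * of_int k * z))) has_field_derivative
      2 * pi * \<i> * of_int k * exp (\<i> * (2 * pi * of_int k * of_real x))) (at (of_real x))"
    by (auto intro!: derivative_eq_intros simp: mult_ac)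
  from has_vector_derivative_real_field[OF this] show ?thesis
    by (auto simp: expi_def[abs_def] mult_ac intro: has_vector_derivative_at_within)
qed

lemma integrable_mult_expi:
  "integrable I01 f \<Longrightarrow> integrable I01 (\<lambda>x. f x * expi k x)"
  by (intro integrable_mult_continuous continuous_intros)

lemma ip01_expi: "ip01 f (expi k) = (\<integral>x. f x * expi (- k) x \<partial>I01)"
  by (simp add: ip01_eq cnj_expi)

lemma ip01_mult_expi: "ip01 (\<lambda>x. f x * expi j x) (expi k) = ip01 f (expi (k - j))"
  unfolding ip01_expi using expi_add[of j "-k"] by (simp add: mult.assoc)

lemma norm_ip01_expi_le: "norm (ip01 f (expi k)) \<le> (\<integral>x. norm (f x) \<partial>I01)"
  unfolding ip01_expi by (rule order.trans[OF integral_norm_bound]) (simp add: norm_mult)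

lemma ip01_lincomb:
  assumes "integrable I01 f" "integrable I01 g"
  shows "ip01 (\<lambda>x. a * f x + b * g x) (expi k) = a * ip01 f (expi k) + b * ip01 g (expi k)"
  unfolding ip01_expi using integrable_mult_expi[OF assms(1), of "-k"] integrable_mult_expi[OF assms(2), of "-k"]
  by (simp add: algebra_simps)

lemma ip01_cong_AE:
  assumes "AE x in I01. f x = g x" "f \<in> borel_measurable I01" "g \<in> borel_measurable I01"
  shows "ip01 f (expi k) = ip01 g (expi k)"
proof -
  have [measurable]: "expi (-k) \<in> borel_measurable I01"
    by (intro measurable_01_continuous continuous_intros)
  note [measurable] = assms(2,3)
  show ?thesis
  unfolding ip01_expi using assms(1) by (intro integral_cong_AE) auto
qed

lemma ip01_cong:
  assumes "\<And>x. x \<in> {0..1} \<Longrightarrow> f x = g x"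
  shows "ip01 f h = ip01 g h"
  unfolding ip01_eq using assms by (intro Bochner_Integration.integral_cong) auto

section \<open>Integration by parts\<close>

text \<open>An absolutely continuous function is given here only through the Lebesgue integral of its derivative;
continuity is read off from the indefinite Henstock--Kurzweil integral, with which that integral agrees.\<close>

lemma has_ac_derivative_continuous:
  assumes "has_ac_derivative F f"
  shows "continuous_on {0..1} F"
proof -
  have f: "f absolutely_integrable_on {0..1}"
    using assms unfolding has_ac_derivative_def by blast
  have F: "F x = F 0 + integral {0..x} f" if x: "x \<in> {0..1}" for x
  proof -
    have "f absolutely_integrable_on {0..x}"
      using f by (rule set_integrable_subset) (use x in auto)
    then have "(LINT t:{0..x}|lebesgue. f t) = integral {0..x} f"
      by (rule set_lebesgue_integral_eq_integral)
    then show ?thesis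
      using assms x unfolding has_ac_derivative_def by metis
  qed
  have "f integrable_on {0..1}"
    using f by (rule set_lebesgue_integral_eq_integral(1))
  then have "continuous_on {0..1} (\<lambda>x. F 0 + integral {0..x} f)"
    by (intro continuous_intros indefinite_integral_continuous_1)
  then show ?thesis
    by (rule continuous_on_eq) (rule F[symmetric])
qed

text \<open>The derivative of \<open>F\<close> exists only almost everywhere, so the product rule is not available. Writing both
\<open>F\<close> and \<open>g\<close> as indefinite integrals turns the claim into Fubini's theorem for
\<open>f t * g' x\<close> on the triangle \<open>0 \<le> t \<le> x \<le> 1\<close>.\<close>

lemma integration_by_parts_ac:
  assumes F: "has_ac_derivative F f"
    and g: "\<And>x. x \<in> {0..1} \<Longrightarrow> (g has_vector_derivative g' x) (at x within {0..1})"
    and g': "continuous_on {0..1} g'"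
  shows "(\<integral>x. f x * g x \<partial>I01) = F 1 * g 1 - F 0 * g 0 - (\<integral>x. F x * g' x \<partial>I01)"
proof -
  interpret finite_measure I01 by (rule finite_measure_lebesgue_on) simp
  interpret P: pair_sigma_finite I01 I01 by standard
  have f: "integrable I01 f"
    using F unfolding has_ac_derivative_def absolutely_integrable_01_iff by blast
  have Fx: "F x = F 0 + (\<integral>t. indicator {0..x} t *\<^sub>R f t \<partial>I01)" if "x \<in> {0..1}" for x
  proof -
    have "F x = F 0 + (LINT t:{0..x}|lebesgue. f t)"
      using F that unfolding has_ac_derivative_def by blast
    then show ?thesis
      unfolding set_integral_01_eq[OF that] .
  qed
  have gx: "g t = g 1 - (\<integral>x. indicator {t..1} x *\<^sub>R g' x \<partial>I01)" if "t \<in> {0..1}" for t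
  proof -
    have "(g' has_integral g 1 - g t) {t..1}"
    proof (rule fundamental_theorem_of_calculus)
      fix x assume "x \<in> {t..1}"
      then have "x \<in> {0..1}" using that by simp
      from g[OF this] show "(g has_vector_derivative g' x) (at x within {t..1})"
        by (rule has_vector_derivative_within_subset) (use that in simp)
    qed (use that in simp)
    then have "integral {t..1} g' = g 1 - g t"
      by (rule integral_unique)
    moreover have "continuous_on {t..1} g'"
      using that by (intro continuous_on_subset[OF g']) auto
    then have "(\<integral>x. indicator {t..1} x *\<^sub>R g' x \<partial>I01) = integral {t..1} g'"
      using that by (intro integral_01_eq_integral) auto
    ultimately have "(\<integral>x. indicator {t..1} x *\<^sub>R g' x \<partial>I01) = g 1 - g t"
      by (rule trans[rotated])
    then show ?thesis by simp
  qed
  obtain B where B: "\<And>x. x \<in> {0..1} \<Longrightarrow> norm (g' x) \<le> B" "B > 0"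
    using continuous_on_01_bounded[OF g'] by metis
  note [measurable] = borel_measurable_integrable[OF f] measurable_01_continuous[OF g']
  define K where "K = (\<lambda>x t. indicat_real {0..x} t *\<^sub>R (f t * g' x))"
  have id1[measurable]: "(\<lambda>x. x) \<in> I01 \<rightarrow>\<^sub>M borel"
    using id_borel_measurable_lebesgue_on[of "{0..1}"] by (simp add: id_def)
  have K_meas[measurable]: "case_prod K \<in> borel_measurable (I01 \<Otimes>\<^sub>M I01)"
  proof -
    have "case_prod K = (\<lambda>z. if 0 \<le> snd z \<and> snd z \<le> fst z then f (snd z) * g' (fst z) else 0)"
      by (auto simp: K_def indicator_def fun_eq_iff)
    then show ?thesis by simp
  qed
  have K_int: "integrable (I01 \<Otimes>\<^sub>M I01) (case_prod K)"
  proof (rule Bochner_Integration.integrable_bound)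
    show "integrable (I01 \<Otimes>\<^sub>M I01) (\<lambda>(x,t). of_real B * f t)"
      using f by (intro P.Fubini_integrable) (auto simp: norm_mult)
    show "AE z in I01 \<Otimes>\<^sub>M I01. norm (case_prod K z) \<le> norm (case z of (x, t) \<Rightarrow> B * f t)"
      using B by (intro AE_I2) (auto simp: K_def space_pair_measure norm_mult indicator_def mult.commute[of B] intro!: mult_left_mono)
  qed measurable
  have "(\<integral>x. (F x - F 0) * g' x \<partial>I01) = (\<integral>x. (\<integral>t. K x t \<partial>I01) \<partial>I01)"
  proof (rule Bochner_Integration.integral_cong[OF refl])
    fix x assume "x \<in> space I01"
    then have "(F x - F 0) * g' x = (\<integral>t. indicator {0..x} t *\<^sub>R f t \<partial>I01) * g' x"
      using Fx[of x] by simp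
    also have "\<dots> = (\<integral>t. (indicator {0..x} t *\<^sub>R f t) * g' x \<partial>I01)"
      by (rule integral_mult_left_zero[symmetric])
    also have "\<dots> = (\<integral>t. K x t \<partial>I01)"
      by (simp add: K_def)
    finally show "(F x - F 0) * g' x = (\<integral>t. K x t \<partial>I01)" .
  qed
  also have "\<dots> = (\<integral>t. (\<integral>x. K x t \<partial>I01) \<partial>I01)"
    by (rule P.Fubini_integral[OF K_int, symmetric])
  also have "\<dots> = (\<integral>t. f t * (g 1 - g t) \<partial>I01)"
  proof (rule Bochner_Integration.integral_cong[OF refl])
    fix t assume t: "t \<in> space I01"
    have "(\<integral>x. K x t \<partial>I01) = (\<integral>x. f t * (indicator {t..1} x *\<^sub>R g' x) \<partial>I01)"
      using t by (intro Bochner_Integration.integral_cong) (auto simp: K_def indicator_def)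
    also have "\<dots> = f t * (\<integral>x. indicator {t..1} x *\<^sub>R g' x \<partial>I01)"
      by (rule integral_mult_right_zero)
    also have "\<dots> = f t * (g 1 - g t)"
      using gx[of t] t by simp
    finally show "(\<integral>x. K x t \<partial>I01) = f t * (g 1 - g t)" .
  qed
  finally have *: "(\<integral>x. (F x - F 0) * g' x \<partial>I01) = (\<integral>t. f t * (g 1 - g t) \<partial>I01)" .
  have gc: "continuous_on {0..1} g"
    using g by (rule continuous_on_vector_derivative)
  have "continuous_on {0..1} F"
    using F by (rule has_ac_derivative_continuous)
  then have 1: "(\<integral>x. (F x - F 0) * g' x \<partial>I01) = (\<integral>x. F x * g' x \<partial>I01) - F 0 * (\<integral>x. g' x \<partial>I01)"
    using integrable_mult_continuous[OF integrable_01_continuous g', of F] integrable_01_continuous[OF g']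
    by (simp add: algebra_simps)
  have 2: "(\<integral>t. f t * (g 1 - g t) \<partial>I01) = (\<integral>t. f t \<partial>I01) * g 1 - (\<integral>t. f t * g t \<partial>I01)"
    using integrable_mult_continuous[OF f gc] f by (simp add: algebra_simps)
  have 3: "(\<integral>t. f t \<partial>I01) = F 1 - F 0"
  proof -
    have "(\<integral>t. indicator {0..1} t *\<^sub>R f t \<partial>I01) = (\<integral>t. f t \<partial>I01)"
      by (intro Bochner_Integration.integral_cong) auto
    then show ?thesis using Fx[of 1] by simp
  qed
  have 4: "(\<integral>t. g' t \<partial>I01) = g 1 - g 0"
  proof -
    have "(\<integral>t. indicator {0..1} t *\<^sub>R g' t \<partial>I01) = (\<integral>t. g' t \<partial>I01)"
      by (intro Bochner_Integration.integral_cong) auto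
    then show ?thesis using gx[of 0] by simp
  qed
  show ?thesis
    using * unfolding 1 2 3 4 by (simp add: algebra_simps)
qed

text \<open>Differentiation of a periodic absolutely continuous function multiplies the \<open>k\<close>-th Fourier coefficient by
\<open>2 \<pi> i k\<close>. This is the only way in which the differential operator enters the later arguments.\<close>

lemma ip01_ac_derivative:
  assumes "has_ac_derivative F f" "F 1 = F 0"
  shows "ip01 f (expi k) = 2 * pi * \<i> * of_int k * ip01 F (expi k)"
proof -
  have "(\<integral>x. f x * expi (-k) x \<partial>I01) = F 1 * expi (-k) 1 - F 0 * expi (-k) 0
      - (\<integral>x. F x * (2 * pi * \<i> * of_int (-k) * expi (-k) x) \<partial>I01)"
    by (rule integration_by_parts_ac[OF assms(1) expi_has_vector_derivative]) (intro continuous_intros)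
  also have "\<dots> = - (\<integral>x. (2 * pi * \<i> * of_int (-k)) * (F x * expi (-k) x) \<partial>I01)"
    using assms(2) by (simp add: mult_ac)
  also have "\<dots> = - ((2 * pi * \<i> * of_int (-k)) * (\<integral>x. F x * expi (-k) x \<partial>I01))"
    by (simp only: integral_mult_right_zero)
  finally show ?thesis by (simp add: ip01_expi)
qed

lemma continuous_derivative_imp_ac:
  assumes y: "\<And>x. x \<in> {0..1} \<Longrightarrow> (y has_vector_derivative y' x) (at x within {0..1})"
    and y': "continuous_on {0..1} y'"
  shows "has_ac_derivative y y'"
  unfolding has_ac_derivative_def absolutely_integrable_01_iff
proof (intro conjI ballI)
  show "integrable I01 y'"
    using y' by (rule integrable_01_continuous)
  fix x :: real assume x: "x \<in> {0..1}"
  have "(y' has_integral y x - y 0) {0..x}"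
  proof (rule fundamental_theorem_of_calculus)
    fix u assume "u \<in> {0..x}"
    then have "u \<in> {0..1}" using x by simp
    from y[OF this] show "(y has_vector_derivative y' u) (at u within {0..x})"
      by (rule has_vector_derivative_within_subset) (use x in simp)
  qed (use x in simp)
  moreover have "continuous_on {0..x} y'"
    using x by (intro continuous_on_subset[OF y']) auto
  then have "(LINT t:{0..x}|lebesgue. y' t) = integral {0..x} y'"
    by (intro set_lebesgue_integral_eq_integral absolutely_integrable_continuous_real)
  ultimately show "y x = y 0 + (LINT t:{0..x}|lebesgue. y' t)"
    by (simp add: integral_unique)
qed

lemma ac_derivative_continuous_imp_derivative:
  assumes F: "has_ac_derivative F f" and f: "continuous_on {0..1} f" and x: "x \<in> {0..1}"
  shows "(F has_vector_derivative f x) (at x within {0..1})"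
proof -
  have *: "F 0 + integral {0..u} f = F u" if u: "u \<in> {0..1}" for u
  proof -
    have "continuous_on {0..u} f"
      using u by (intro continuous_on_subset[OF f]) auto
    then have "(LINT t:{0..u}|lebesgue. f t) = integral {0..u} f"
      by (intro set_lebesgue_integral_eq_integral absolutely_integrable_continuous_real)
    then show ?thesis
      using F u unfolding has_ac_derivative_def by metis
  qed
  have "((\<lambda>u. F 0 + integral {0..u} f) has_vector_derivative 0 + f x) (at x within {0..1})"
    by (intro derivative_intros integral_has_vector_derivative[OF f x])
  then have "((\<lambda>u. F 0 + integral {0..u} f) has_vector_derivative f x) (at x within {0..1})"
    by simp
  from has_vector_derivative_transform[OF x *[symmetric] this] show ?thesis by simp
qed

lemma has_ac_derivative_antiderivative:
  assumes "integrable I01 f"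
  shows "has_ac_derivative (\<lambda>x. C + (LINT t:{0..x}|lebesgue. f t)) f"
proof -
  have f: "f absolutely_integrable_on {0..1}"
    using assms by (simp add: absolutely_integrable_01_iff)
  have "(LINT t:{0..0}|lebesgue. f t) = integral {0..0} f"
    by (rule set_lebesgue_integral_eq_integral, rule set_integrable_subset[OF f]) auto
  then have "(LINT t:{0..0}|lebesgue. f t) = 0"
    by simp
  then show ?thesis
    using assms by (simp add: has_ac_derivative_def absolutely_integrable_01_iff)
qed

lemma ip01_ac_derivative_0:
  assumes "has_ac_derivative F f"
  shows "ip01 f (expi 0) = F 1 - F 0"
proof -
  have "\<forall>x\<in>{0..1}. F x = F 0 + (LINT t:{0..x}|lebesgue. f t)"
    using assms unfolding has_ac_derivative_def by blast
  then have "F 1 = F 0 + (LINT t:{0..1}|lebesgue. f t)"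
    by (rule bspec) simp
  then show ?thesis by (simp add: ip01_def)
qed

section \<open>Uniqueness of Fourier coefficients\<close>

text \<open>The uniqueness theorem is easiest through the set of integrable functions all of whose Fourier
coefficients vanish: it is stable under multiplication by exponentials, hence by every polynomial in the real
and imaginary parts of \<open>expi 1\<close>.\<close>

definition fourier_null :: "(real \<Rightarrow> complex) set" where
  "fourier_null = {f. integrable I01 f \<and> (\<forall>k. ip01 f (expi k) = 0)}"

lemma fourier_null_lincomb:
  assumes "f \<in> fourier_null" "g \<in> fourier_null"
  shows "(\<lambda>x. a * f x + b * g x) \<in> fourier_null"
  using assms by (auto simp: fourier_null_def ip01_lincomb)

lemma fourier_null_mult_expi:
  assumes "f \<in> fourier_null"
  shows "(\<lambda>x. f x * expi j x) \<in> fourier_null"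
  using assms integrable_mult_expi by (auto simp: fourier_null_def ip01_mult_expi)

text \<open>Stability under multiplication, rather than orthogonality to \<open>p\<close>, is the statement that survives
the product case of the induction.\<close>

lemma fourier_null_mult_polynomial:
  fixes p :: "complex \<Rightarrow> real"
  assumes "real_polynomial_function p" "f \<in> fourier_null"
  shows "(\<lambda>x. f x * of_real (p (expi 1 x))) \<in> fourier_null"
  using assms
proof (induction arbitrary: f)
  case (linear l)
  then interpret l: bounded_linear l by simp
  \<comment> \<open>Every real-linear functional on the plane is \<open>u * z + v * cnj z\<close>.\<close>
  define u where "u = (complex_of_real (l 1) - \<i> * of_real (l \<i>)) / 2"
  define v where "v = (complex_of_real (l 1) + \<i> * of_real (l \<i>)) / 2"
  have "of_real (l z) = u * z + v * cnj z" for z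
  proof -
    have "l z = l (Re z *\<^sub>R 1 + Im z *\<^sub>R \<i>)"
      by (simp add: scaleR_conv_of_real mult.commute[of _ \<i>] complex_eq[symmetric])
    also have "\<dots> = Re z * l 1 + Im z * l \<i>"
      by (simp only: l.add l.scaleR real_scaleR_def)
    finally show ?thesis
      by (simp add: u_def v_def complex_eq_iff field_simps)
  qed
  then have "(\<lambda>x. f x * of_real (l (expi 1 x))) = (\<lambda>x. u * (f x * expi 1 x) + v * (f x * expi (-1) x))"
    by (simp add: cnj_expi algebra_simps)
  then show ?case
    using linear.prems by (simp add: fourier_null_lincomb fourier_null_mult_expi)
next
  case (const c)
  then show ?case
    using fourier_null_lincomb[of f f "of_real c" 0] by (simp add: mult.commute)
next
  case (add p1 p2)
  then show ?case
    using fourier_null_lincomb[of "\<lambda>x. f x * of_real (p1 (expi 1 x))" "\<lambda>x. f x * of_real (p2 (expi 1 x))" 1 1]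
    by (simp add: algebra_simps)
next
  case (mult p1 p2)
  then show ?case
    using mult.IH(2)[OF mult.IH(1)[OF mult.prems]] by (simp add: mult.assoc)
qed

text \<open>Trigonometric approximation of periodic functions is Stone--Weierstrass on the unit circle. That a closed
path factors continuously through the circle is extracted from the correspondence between homotopic
loops and homotopic circle maps, applied to the constant homotopy of \<open>f\<close>.\<close>

lemma circle_polynomial_approx:
  fixes f :: "real \<Rightarrow> real"
  assumes f: "continuous_on {0..1} f" "f 0 = f 1" and "e > 0"
  obtains p :: "complex \<Rightarrow> real" where "real_polynomial_function p"
    "\<And>x. x \<in> {0..1} \<Longrightarrow> \<bar>f x - p (expi 1 x)\<bar> < e"
proof -
  have "homotopic_loops UNIV f f"
    using f by (simp add: homotopic_loops_refl path_def pathstart_def pathfinish_def)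
  then have "continuous_on (sphere 0 1) (f \<circ> (\<lambda>z. Arg2pi z / (2 * pi)))"
    using homotopic_loops_imp_homotopic_circlemaps homotopic_with_imp_continuous by blast
  from Stone_Weierstrass_real_polynomial_function[OF compact_sphere this \<open>e > 0\<close>]
  obtain p where p: "real_polynomial_function p"
    "\<And>z. z \<in> sphere 0 1 \<Longrightarrow> \<bar>(f \<circ> (\<lambda>z. Arg2pi z / (2 * pi))) z - p z\<bar> < e"
    by blast
  have "f (Arg2pi (expi 1 x) / (2 * pi)) = f x" if "x \<in> {0..1}" for x
  proof (cases "x = 1")
    case True
    then show ?thesis using f Arg2pi_of_real[of 1] by simp
  next
    case False
    then have "Arg2pi (expi 1 x) = 2 * pi * x"
      using that by (auto simp: expi_def Arg2pi_exp)
    then show ?thesis by simp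
  qed
  then have "\<bar>f x - p (expi 1 x)\<bar> < e" if "x \<in> {0..1}" for x
    using p(2)[of "expi 1 x"] that by simp
  then show thesis
    using that[OF p(1)] by blast
qed

text \<open>If \<open>g\<close> is a trigonometric polynomial close to the conjugate of \<open>f\<close>, then \<open>f * g\<close> has
integral zero, so the integral of \<open>\<bar>f\<bar>\<^sup>2\<close> is that of \<open>f * (cnj f - g)\<close>, which is
arbitrarily small.\<close>

lemma fourier_uniqueness:
  assumes f: "continuous_on {0..1} f" "f 0 = f 1" and null: "\<And>k. ip01 f (expi k) = 0"
    and x: "x \<in> {0..1}"
  shows "f x = 0"
proof -
  have fi: "integrable I01 f"
    using f(1) by (rule integrable_01_continuous)
  have fn: "f \<in> fourier_null"
    using fi null by (simp add: fourier_null_def)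
  have sq: "integrable I01 (\<lambda>x. (norm (f x))\<^sup>2)"
    using continuous_imp_L2_01[OF f(1)] by (simp add: L2_01_def)
  define I where "I = (\<integral>x. (norm (f x))\<^sup>2 \<partial>I01)"
  define J where "J = (\<integral>x. norm (f x) \<partial>I01)"
  have "J \<ge> 0" by (simp add: J_def)
  have small: "I \<le> 2 * e * J" if "e > 0" for e
  proof -
    obtain p1 where p1: "real_polynomial_function p1"
      "\<And>x. x \<in> {0..1} \<Longrightarrow> \<bar>Re (f x) - p1 (expi 1 x)\<bar> < e"
    proof (rule circle_polynomial_approx)
      show "continuous_on {0..1} (\<lambda>x. Re (f x))"
        using f(1) by (intro continuous_intros)
    qed (use f \<open>e > 0\<close> in auto)
    obtain p2 where p2: "real_polynomial_function p2"
      "\<And>x. x \<in> {0..1} \<Longrightarrow> \<bar>Im (f x) - p2 (expi 1 x)\<bar> < e"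
    proof (rule circle_polynomial_approx)
      show "continuous_on {0..1} (\<lambda>x. Im (f x))"
        using f(1) by (intro continuous_intros)
    qed (use f \<open>e > 0\<close> in auto)
    note p = p1 p2
    define g where "g = (\<lambda>x. of_real (p1 (expi 1 x)) - \<i> * of_real (p2 (expi 1 x)))"
    have close: "norm (cnj (f x) - g x) \<le> 2 * e" if "x \<in> {0..1}" for x
    proof -
      have "norm (cnj (f x) - g x) \<le> \<bar>Re (cnj (f x) - g x)\<bar> + \<bar>Im (cnj (f x) - g x)\<bar>"
        by (rule cmod_le)
      also have "\<dots> \<le> e + e"
        using p(2)[OF that] p(4)[OF that] by (intro add_mono) (auto simp: g_def)
      finally show ?thesis by simp
    qed
    have "(\<lambda>x. f x * g x) \<in> fourier_null"
      using fourier_null_lincomb[OF fourier_null_mult_polynomial[OF p(1) fn] fourier_null_mult_polynomial[OF p(3) fn], of 1 "-\<i>"]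
      by (simp add: g_def algebra_simps)
    then have fg: "integrable I01 (\<lambda>x. f x * g x)" "(\<integral>x. f x * g x \<partial>I01) = 0"
      by (auto simp: fourier_null_def ip01_expi dest: spec[of _ 0])
    have ff: "integrable I01 (\<lambda>x. f x * cnj (f x))"
      using fi f(1) by (intro integrable_mult_continuous continuous_intros)
    have "I = norm (\<integral>x. f x * cnj (f x) \<partial>I01)"
    proof -
      have "(\<integral>x. f x * cnj (f x) \<partial>I01) = (\<integral>x. of_real ((norm (f x))\<^sup>2) \<partial>I01)"
        by (simp add: complex_norm_square[symmetric])
      also have "\<dots> = of_real I"
        unfolding I_def by (rule integral_complex_of_real)
      finally show ?thesis by (simp add: I_def)
    qed
    also have "(\<integral>x. f x * cnj (f x) \<partial>I01) = (\<integral>x. f x * cnj (f x) - f x * g x \<partial>I01)"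
      using ff fg by simp
    also have "norm \<dots> \<le> (\<integral>x. 2 * e * norm (f x) \<partial>I01)"
    proof (rule Bochner_Integration.integral_norm_bound_integral)
      fix x assume "x \<in> space I01"
      then have "norm (f x) * norm (cnj (f x) - g x) \<le> norm (f x) * (2 * e)"
        by (intro mult_left_mono close) auto
      then show "norm (f x * cnj (f x) - f x * g x) \<le> 2 * e * norm (f x)"
        by (simp add: norm_mult[symmetric] algebra_simps)
    qed (use ff fg fi in auto)
    finally show ?thesis by (simp add: J_def)
  qed
  have "I \<le> 0"
  proof (rule field_le_epsilon)
    fix e :: real assume "e > 0"
    have "I \<le> 2 * (e / (2 * J + 1)) * J"
      using \<open>e > 0\<close> \<open>J \<ge> 0\<close> by (intro small) auto
    also have "\<dots> \<le> e"
      using \<open>e > 0\<close> \<open>J \<ge> 0\<close> by (simp add: field_simps)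
    finally show "I \<le> 0 + e" by simp
  qed
  moreover have "I = integral {0..1} (\<lambda>x. (norm (f x))\<^sup>2)"
    unfolding I_def by (rule lebesgue_integral_eq_integral[OF sq]) simp
  moreover have "0 \<le> integral {0..1} (\<lambda>x. (norm (f x))\<^sup>2)"
    by (rule integral_nonneg) (auto intro!: integrable_continuous_real continuous_intros f)
  ultimately have "integral {0..1} (\<lambda>x. (norm (f x))\<^sup>2) = 0" by linarith
  then have "\<forall>x\<in>{0..1}. (norm (f x))\<^sup>2 = 0"
    by (subst (asm) integral_eq_0_iff) (auto intro!: continuous_intros f)
  then show ?thesis using x by simp
qed

section \<open>Absolutely convergent trigonometric series\<close>

definition trig_series :: "(int \<Rightarrow> complex) \<Rightarrow> real \<Rightarrow> complex" where
  "trig_series a x = (\<Sum>\<^sub>\<infinity>j. a j * expi j x)"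

lemma trig_series_uniform_limit:
  assumes "(\<lambda>j. norm (a j)) summable_on S" "\<And>j. j \<notin> S \<Longrightarrow> a j = 0"
  shows "uniform_limit UNIV (\<lambda>X x. \<Sum>j\<in>X. a j * expi j x) (trig_series a) (finite_subsets_at_top S)"
proof -
  have "uniform_limit UNIV (\<lambda>X x. \<Sum>j\<in>X. a j * expi j x) (\<lambda>x. \<Sum>\<^sub>\<infinity>j\<in>S. a j * expi j x) (finite_subsets_at_top S)"
    by (rule Weierstrass_m_test_general[OF _ assms(1)]) (simp add: norm_mult)
  moreover have "(\<Sum>\<^sub>\<infinity>j\<in>S. a j * expi j x) = trig_series a x" for x
    unfolding trig_series_def by (rule infsum_cong_neutral) (use assms(2) in auto)
  ultimately show ?thesis by simp
qed

lemma continuous_on_trig_series: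
  assumes "(\<lambda>j. norm (a j)) summable_on UNIV"
  shows "continuous_on A (trig_series a)"
proof -
  have "uniform_limit UNIV (\<lambda>X x. \<Sum>j\<in>X. a j * expi j x) (trig_series a) (finite_subsets_at_top UNIV)"
    using assms by (rule trig_series_uniform_limit) simp
  then have "continuous_on UNIV (trig_series a)"
    by (rule uniform_limit_theorem[rotated]) (auto intro!: always_eventually continuous_intros)
  then show ?thesis
    by (rule continuous_on_subset) simp
qed

lemma trig_series_periodic: "trig_series a 1 = trig_series a 0"
  by (simp add: trig_series_def)

text \<open>The product with an integrable function has the convolution of the two coefficient families as its
Fourier coefficients. Uniform convergence of the series suffices, because a Fourier coefficient is bounded by
the \<open>L\<^sub>1\<close> norm.\<close>

lemma fourier_coefficients_product:
  assumes h: "integrable I01 h" and a: "(\<lambda>j. norm (a j)) summable_on UNIV"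
  shows "((\<lambda>j. a j * ip01 h (expi (k - j))) has_sum ip01 (\<lambda>x. h x * trig_series a x) (expi k)) UNIV"
  unfolding has_sum_def
proof (rule tendstoI)
  fix e :: real assume "e > 0"
  define J where "J = (\<integral>x. norm (h x) \<partial>I01)"
  have "J \<ge> 0" by (simp add: J_def)
  define d where "d = e / (2 * (J + 1))"
  have "d > 0" using \<open>e > 0\<close> \<open>J \<ge> 0\<close> by (simp add: d_def)
  have hs: "integrable I01 (\<lambda>x. h x * trig_series a x)"
    using h a by (intro integrable_mult_continuous continuous_on_trig_series)
  have "uniform_limit UNIV (\<lambda>X x. \<Sum>j\<in>X. a j * expi j x) (trig_series a) (finite_subsets_at_top UNIV)"
    using a by (rule trig_series_uniform_limit) simp
  then have "\<forall>\<^sub>F X in finite_subsets_at_top UNIV. \<forall>x\<in>UNIV. dist (\<Sum>j\<in>X. a j * expi j x) (trig_series a x) < d"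
    using \<open>d > 0\<close> by (rule uniform_limitD)
  then show "\<forall>\<^sub>F X in finite_subsets_at_top UNIV.
      dist (\<Sum>j\<in>X. a j * ip01 h (expi (k - j))) (ip01 (\<lambda>x. h x * trig_series a x) (expi k)) < e"
  proof (rule eventually_mono)
    fix X assume X: "\<forall>x\<in>UNIV. dist (\<Sum>j\<in>X. a j * expi j x) (trig_series a x) < d"
    define s where "s = (\<lambda>x. \<Sum>j\<in>X. a j * expi j x)"
    have int: "integrable I01 (\<lambda>x. a j * (h x * expi (- (k - j)) x))" for j
      using integrable_mult_expi[OF h] by simp
    have eq: "h x * s x * expi (-k) x = (\<Sum>j\<in>X. a j * (h x * expi (- (k - j)) x))" for x
    proof -
      have "expi (- (k - j)) x = expi j x * expi (-k) x" for j
        using expi_add[of j "-k" x] by (simp add: algebra_simps)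
      then show ?thesis
        by (simp add: s_def sum_distrib_left sum_distrib_right mult_ac)
    qed
    have "(\<Sum>j\<in>X. a j * ip01 h (expi (k - j))) = (\<integral>x. h x * s x * expi (-k) x \<partial>I01)"
      unfolding eq ip01_expi using int by (subst Bochner_Integration.integral_sum) auto
    moreover have i1: "integrable I01 (\<lambda>x. h x * s x * expi (-k) x)"
      unfolding eq using int by (intro Bochner_Integration.integrable_sum)
    have i2: "integrable I01 (\<lambda>x. h x * trig_series a x * expi (-k) x)"
      using hs by (rule integrable_mult_expi)
    have "norm ((\<integral>x. h x * s x * expi (-k) x \<partial>I01) - ip01 (\<lambda>x. h x * trig_series a x) (expi k)) \<le> d * J"
    proof -
      have "(\<integral>x. h x * s x * expi (-k) x \<partial>I01) - ip01 (\<lambda>x. h x * trig_series a x) (expi k)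
          = (\<integral>x. h x * s x * expi (-k) x - h x * trig_series a x * expi (-k) x \<partial>I01)"
        unfolding ip01_expi using i1 i2 by simp
      also have "norm \<dots> \<le> (\<integral>x. d * norm (h x) \<partial>I01)"
      proof (rule Bochner_Integration.integral_norm_bound_integral)
        fix x
        have "h x * s x * expi (-k) x - h x * trig_series a x * expi (-k) x
            = (s x - trig_series a x) * h x * expi (-k) x"
          by (simp add: algebra_simps)
        moreover have "norm (s x - trig_series a x) * norm (h x) \<le> d * norm (h x)"
          using X by (intro mult_right_mono) (auto simp: s_def dist_norm less_imp_le)
        ultimately show "norm (h x * s x * expi (-k) x - h x * trig_series a x * expi (-k) x) \<le> d * norm (h x)"
          by (simp add: norm_mult)
      qed (use i1 i2 h in auto)
      finally show ?thesis by (simp add: J_def)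
    qed
    moreover have "d * J < e"
    proof -
      have "0 < e * (J + 2)"
        using \<open>e > 0\<close> \<open>J \<ge> 0\<close> by simp
      then show ?thesis
        using \<open>J \<ge> 0\<close> by (simp add: d_def field_simps)
    qed
    ultimately show "dist (\<Sum>j\<in>X. a j * ip01 h (expi (k - j))) (ip01 (\<lambda>x. h x * trig_series a x) (expi k)) < e"
      by (simp add: dist_norm)
  qed
qed

lemma ip01_one_expi: "ip01 (\<lambda>x. 1) (expi k) = (if k = 0 then 1 else 0)"
proof (cases "k = 0")
  case True
  have "measure lebesgue {0..1::real} = 1" by simp
  then show ?thesis using True by (simp add: ip01_def set_lebesgue_integral_def set_integral_const)
next
  case False
  have "has_ac_derivative (\<lambda>x. 1) (\<lambda>x. 0)"
    by (rule continuous_derivative_imp_ac) auto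
  then have "ip01 (\<lambda>x. 0) (expi k) = 2 * pi * \<i> * of_int k * ip01 (\<lambda>x. 1) (expi k)"
    by (rule ip01_ac_derivative) simp
  then show ?thesis using False by (simp add: ip01_eq)
qed

lemma fourier_coefficients_trig_series:
  assumes "(\<lambda>j. norm (a j)) summable_on UNIV"
  shows "ip01 (trig_series a) (expi k) = a k"
proof -
  have "((\<lambda>j. a j * ip01 (\<lambda>x. 1) (expi (k - j))) has_sum ip01 (\<lambda>x. 1 * trig_series a x) (expi k)) UNIV"
    by (rule fourier_coefficients_product[OF integrable_01_const assms])
  moreover have "((\<lambda>j. a j * ip01 (\<lambda>x. 1) (expi (k - j))) has_sum a k) UNIV"
    by (rule has_sum_finite_neutralI[of "{k}"]) (auto simp: ip01_one_expi)
  ultimately show ?thesis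
    by (auto dest: has_sum_unique)
qed

text \<open>A function with absolutely summable coefficients is represented by its Fourier series: the difference is
continuous and periodic, and all its coefficients vanish.\<close>

lemma trig_series_of_fourier_coefficients:
  assumes "continuous_on {0..1} f" "f 0 = f 1" "(\<lambda>k. norm (ip01 f (expi k))) summable_on UNIV"
    and "x \<in> {0..1}"
  shows "f x = trig_series (\<lambda>k. ip01 f (expi k)) x"
proof -
  let ?S = "trig_series (\<lambda>k. ip01 f (expi k))"
  have "1 * f x + (-1) * ?S x = 0"
  proof (rule fourier_uniqueness)
    show "continuous_on {0..1} (\<lambda>x. 1 * f x + (-1) * ?S x)"
      using assms by (intro continuous_intros continuous_on_trig_series)
    show "1 * f 0 + (-1) * ?S 0 = 1 * f 1 + (-1) * ?S 1"
      using assms(2) by (simp add: trig_series_periodic)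
    show "ip01 (\<lambda>x. 1 * f x + (-1) * ?S x) (expi k) = 0" for k
      by (subst ip01_lincomb)
        (use assms in \<open>auto simp: fourier_coefficients_trig_series intro!: integrable_01_continuous continuous_on_trig_series\<close>)
  qed fact
  then show ?thesis by simp
qed

text \<open>The intervals \<open>{m..m + N}\<close> are cofinal among the finite sets of frequencies at least \<open>m\<close>, so the
ordered partial sums in \<open>has_form\<close> inherit the uniform convergence of the unordered sum.\<close>

lemma has_form_trig_series:
  assumes a: "(\<lambda>j. norm (a j)) summable_on UNIV" "\<And>j. j < m \<Longrightarrow> a j = 0" "a m = 1"
    and F: "\<And>x. x \<in> {0..1} \<Longrightarrow> F x = trig_series a x"
  shows "has_form m F"
proof -
  have "(\<lambda>j. norm (a j)) summable_on {m..}"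
    using a(1) by (rule summable_on_subset_banach) simp
  then have "uniform_limit UNIV (\<lambda>X x. \<Sum>j\<in>X. a j * expi j x) (trig_series a) (finite_subsets_at_top {m..})"
    by (rule trig_series_uniform_limit) (use a(2) in auto)
  moreover have "filterlim (\<lambda>N. {m..m + int N}) (finite_subsets_at_top {m..}) sequentially"
    unfolding filterlim_finite_subsets_at_top
  proof (intro allI impI)
    fix X assume X: "finite X \<and> X \<subseteq> {m..}"
    then obtain b where b: "\<And>j. j \<in> X \<Longrightarrow> j \<le> b"
      using bdd_above_finite[of X] by (auto simp: bdd_above_def)
    have "X \<subseteq> {m..m + int N}" if "N \<ge> nat (b - m)" for N
      using X b that by force
    then show "\<forall>\<^sub>F N in sequentially. finite {m..m + int N} \<and> X \<subseteq> {m..m + int N} \<and> {m..m + int N} \<subseteq> {m..}"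
      by (intro eventually_sequentiallyI[of "nat (b - m)"]) auto
  qed
  ultimately have "uniform_limit UNIV (\<lambda>N x. \<Sum>j\<in>{m..m + int N}. a j * expi j x) (trig_series a) sequentially"
    by (rule filterlim_compose)
  then have "uniform_limit {0..1} (\<lambda>N x. \<Sum>j\<in>{m..m + int N}. a j * expi j x) (trig_series a) sequentially"
    by (rule uniform_limit_on_subset) simp
  moreover have "(\<Sum>j\<in>{m..m + int N}. a j * expi j x) = expi m x + (\<Sum>p=1..N. a (m + int p) * expi (m + int p) x)" for N x
  proof (induction N)
    case (Suc N)
    have "{m..m + int (Suc N)} = insert (m + int (Suc N)) {m..m + int N}" by auto
    then show ?case using Suc by (simp add: add_ac)
  qed (simp add: a(3))
  ultimately have "uniform_limit {0..1} (\<lambda>N x. expi m x + (\<Sum>p=1..N. a (m + int p) * expi (m + int p) x)) (trig_series a) sequentially"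
    by simp
  then have "uniform_limit {0..1} (\<lambda>N x. expi m x + (\<Sum>p=1..N. a (m + int p) * expi (m + int p) x)) F sequentially"
    using F by (subst uniform_limit_cong'[OF _ F]) auto
  then show ?thesis
    unfolding has_form_def by (intro exI[of _ "\<lambda>p. a (m + int p)"])
qed

lemma abs_summable_on_int:
  fixes a :: "int \<Rightarrow> complex"
  assumes "summable (\<lambda>n. norm (a (int n)))" "summable (\<lambda>n. norm (a (- int n)))"
  shows "(\<lambda>j. norm (a j)) summable_on UNIV"
proof -
  have "(\<lambda>k. norm (a k)) summable_on (range int \<union> range (\<lambda>n. - int n))"
  proof (rule summable_on_union)
    show "(\<lambda>k. norm (a k)) summable_on range int"
      using assms(1) by (subst summable_on_reindex) (auto simp: inj_def o_def summable_on_UNIV_nonneg_real_iff)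
    show "(\<lambda>k. norm (a k)) summable_on range (\<lambda>n. - int n)"
      using assms(2) by (subst summable_on_reindex) (auto simp: inj_def o_def summable_on_UNIV_nonneg_real_iff)
  qed
  moreover have "range int \<union> range (\<lambda>n. - int n) = UNIV"
  proof -
    have "k \<in> range int \<union> range (\<lambda>n. - int n)" for k
      by (cases k rule: int_cases2) auto
    then show ?thesis by blast
  qed
  ultimately show ?thesis by simp
qed

section \<open>The operator in terms of Fourier coefficients\<close>

text \<open>A mean-zero function has periodic antiderivatives, and the mean of the antiderivative can be prescribed
by the constant of integration.\<close>

lemma periodic_antiderivative:
  assumes f: "integrable I01 f" and mean: "ip01 f (expi 0) = 0"
  obtains F where "has_ac_derivative F f" "F 1 = F 0" "ip01 F (expi 0) = c"
proof -
  define P where "P C x = C + (LINT t:{0..x}|lebesgue. f t)" for C x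
  have ac: "has_ac_derivative (P C) f" for C
    unfolding P_def using f by (rule has_ac_derivative_antiderivative)
  have i: "integrable I01 (P 0)"
    using ac has_ac_derivative_continuous integrable_01_continuous by blast
  define C where "C = c - ip01 (P 0) (expi 0)"
  have "ip01 (P C) (expi 0) = ip01 (\<lambda>x. C * 1 + 1 * P 0 x) (expi 0)"
    by (rule ip01_cong) (simp add: P_def)
  also have "\<dots> = C * ip01 (\<lambda>x. 1) (expi 0) + 1 * ip01 (P 0) (expi 0)"
    by (rule ip01_lincomb) (auto simp: i)
  also have "\<dots> = c"
    by (simp add: ip01_one_expi C_def)
  finally show thesis
    using that[OF ac[of C]] ip01_ac_derivative_0[OF ac[of C]] mean by simp
qed

text \<open>Membership in the domain can be tested on Fourier coefficients. If \<open>g\<close> has the coefficients that the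
second derivative of \<open>y\<close> would have, integrate \<open>g\<close> twice, choosing the constants so that the
result has the coefficients of \<open>y\<close>; by uniqueness the result is \<open>y\<close>.\<close>

lemma L0_trig_series:
  fixes a :: "int \<Rightarrow> complex"
  assumes a: "(\<lambda>j. norm (a j)) summable_on UNIV" and g: "integrable I01 g"
    and coeff: "\<And>k. ip01 g (expi k) = - ((2 * pi * of_int k)\<^sup>2) * a k"
    and y: "\<And>x. y x = (if x \<in> {0..1} then trig_series a x else 0)"
    and z: "z \<in> L2_01" "AE x in I01. z x = - g x + q x * y x"
  shows "L0 q y z"
proof -
  have "ip01 g (expi 0) = 0" by (simp add: coeff)
  then obtain G where G: "has_ac_derivative G g" "G 1 = G 0" "ip01 G (expi 0) = 0"
    using periodic_antiderivative[OF g] by metis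
  have Gc: "continuous_on {0..1} G"
    using G(1) by (rule has_ac_derivative_continuous)
  obtain H where H: "has_ac_derivative H G" "H 1 = H 0" "ip01 H (expi 0) = a 0"
    using periodic_antiderivative[OF integrable_01_continuous[OF Gc] G(3)] by metis
  have Hc: "continuous_on {0..1} H"
    using H(1) by (rule has_ac_derivative_continuous)
  have H_coeff: "ip01 H (expi k) = a k" for k
  proof (cases "k = 0")
    case False
    have "- ((2 * pi * of_int k)\<^sup>2) * a k = (2 * pi * \<i> * of_int k) * ((2 * pi * \<i> * of_int k) * ip01 H (expi k))"
      using ip01_ac_derivative[OF G(1,2), of k] ip01_ac_derivative[OF H(1,2), of k] coeff[of k] by simp
    also have "\<dots> = - ((2 * pi * of_int k)\<^sup>2) * ip01 H (expi k)"
      by (simp add: power2_eq_square)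
    finally show ?thesis using False by simp
  qed (simp add: H(3))
  have y_H: "y x = H x" if "x \<in> {0..1}" for x
    using trig_series_of_fourier_coefficients[OF Hc H(2)[symmetric] _ that] that a by (simp add: H_coeff y)
  show ?thesis
    unfolding L0_def
  proof (intro conjI exI allI impI ballI)
    fix x :: real assume x: "x \<in> {0..1}"
    show "(y has_vector_derivative G x) (at x within {0..1})"
      by (rule has_vector_derivative_transform[OF x y_H ac_derivative_continuous_imp_derivative[OF H(1) Gc x]])
  qed (use z G H(2) y_H in \<open>auto simp: y\<close>)
qed

lemma eigenspace_continuous:
  assumes "y \<in> eigenspace q l"
  shows "continuous_on {0..1} y" "y 1 = y 0" "\<And>x. x \<notin> {0..1} \<Longrightarrow> y x = 0"
  using assms by (auto simp: eigenspace_def L0_def intro: continuous_on_vector_derivative)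

text \<open>Conversely, integrating by parts twice converts the eigenvalue equation into an equation between Fourier
coefficients. As the second derivative is integrable, the coefficients of \<open>y\<close> are
\<open>O(k\<^sup>-\<^sup>2)\<close> and therefore summable.\<close>

lemma eigenspace_coefficients:
  fixes l :: complex
  assumes q: "integrable I01 q" and y: "y \<in> eigenspace q l"
  shows "((2 * pi * of_int k)\<^sup>2 - l) * ip01 y (expi k) + ip01 (\<lambda>x. q x * y x) (expi k) = 0"
    and "(\<lambda>k. norm (ip01 y (expi k))) summable_on UNIV"
proof -
  obtain y' y'' where y': "\<And>x. x \<in> {0..1} \<Longrightarrow> (y has_vector_derivative y' x) (at x within {0..1})"
    and y'': "has_ac_derivative y' y''" and per: "y 1 = y 0" "y' 1 = y' 0"
    and ae: "AE x in I01. l * y x = - y'' x + q x * y x"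
    using y unfolding eigenspace_def L0_def mem_Collect_eq by blast
  have yc: "continuous_on {0..1} y"
    using y by (rule eigenspace_continuous)
  have yi: "integrable I01 y" and qyi: "integrable I01 (\<lambda>x. q x * y x)"
    using yc q by (auto intro: integrable_01_continuous integrable_mult_continuous)
  have y''i: "integrable I01 y''"
    using y'' unfolding has_ac_derivative_def absolutely_integrable_01_iff by blast
  have ac: "has_ac_derivative y y'"
    by (rule continuous_derivative_imp_ac[OF y' has_ac_derivative_continuous[OF y'']])
  have second: "ip01 y'' (expi k) = - ((2 * pi * of_int k)\<^sup>2) * ip01 y (expi k)" for k
    using ip01_ac_derivative[OF y'' per(2), of k] ip01_ac_derivative[OF ac per(1), of k]
    by (simp add: power2_eq_square)
  have "ip01 y'' (expi k) = ip01 (\<lambda>x. 1 * (q x * y x) + (-l) * y x) (expi k)"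
  proof (rule ip01_cong_AE)
    show "AE x in I01. y'' x = 1 * (q x * y x) + (-l) * y x"
      using ae by eventually_elim (simp add: algebra_simps)
  qed (use yi qyi y''i in auto)
  also have "\<dots> = 1 * ip01 (\<lambda>x. q x * y x) (expi k) + (-l) * ip01 y (expi k)"
    using qyi yi by (rule ip01_lincomb)
  finally show "((2 * pi * of_int k)\<^sup>2 - l) * ip01 y (expi k) + ip01 (\<lambda>x. q x * y x) (expi k) = 0"
    using second[of k] by (simp add: algebra_simps)
  define J where "J = (\<integral>x. norm (y'' x) \<partial>I01)"
  have bound: "norm (ip01 y (expi k)) \<le> J * (1 / real_of_int k ^ 2)" if "k \<noteq> 0" for k
  proof -
    have "real_of_int k ^ 2 * norm (ip01 y (expi k)) \<le> (2 * pi * real_of_int k) ^ 2 * norm (ip01 y (expi k))"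
    proof (rule mult_right_mono)
      have "1 \<le> 2 * pi" using pi_ge_two by simp
      then have "1 ^ 2 \<le> (2 * pi) ^ 2" by (rule power_mono) simp
      from mult_right_mono[OF this, of "real_of_int k ^ 2"]
      show "real_of_int k ^ 2 \<le> (2 * pi * real_of_int k) ^ 2"
        by (simp add: power_mult_distrib)
    qed simp
    also have "\<dots> = norm (ip01 y'' (expi k))"
      unfolding second by (simp add: norm_mult norm_power abs_mult power_mult_distrib)
    also have "\<dots> \<le> J"
      unfolding J_def by (rule norm_ip01_expi_le)
    finally show ?thesis using that by (simp add: field_simps)
  qed
  have s: "summable (\<lambda>n. J * (1 / real n ^ 2))"
    using inverse_power_summable[of 2, where 'a=real] by (intro summable_mult) (simp add: field_simps inverse_eq_divide)
  show "(\<lambda>k. norm (ip01 y (expi k))) summable_on UNIV"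
    by (rule abs_summable_on_int; rule summable_comparison_test'[OF s, of 1])
      (use bound[of "int n" for n] bound[of "- int n" for n] in auto)
qed

lemma eigenspace_trig_series:
  assumes "integrable I01 q" "y \<in> eigenspace q l" "x \<in> {0..1}"
  shows "y x = trig_series (\<lambda>k. ip01 y (expi k)) x"
  using assms eigenspace_continuous[OF assms(2)] eigenspace_coefficients(2)[OF assms(1,2)]
  by (intro trig_series_of_fourier_coefficients) auto

lemma eigenspace_recurrence:
  fixes l :: complex
  assumes q: "integrable I01 q" and y: "y \<in> eigenspace q l"
  shows "((\<lambda>j. ip01 y (expi j) * ip01 q (expi (k - j))) has_sum
      - ((2 * pi * of_int k)\<^sup>2 - l) * ip01 y (expi k)) UNIV"
proof -
  have "ip01 (\<lambda>x. q x * y x) (expi k) = ip01 (\<lambda>x. q x * trig_series (\<lambda>k. ip01 y (expi k)) x) (expi k)"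
    by (rule ip01_cong) (simp add: eigenspace_trig_series[OF q y])
  moreover have "ip01 (\<lambda>x. q x * y x) (expi k) = - ((2 * pi * of_int k)\<^sup>2 - l) * ip01 y (expi k)"
    using eigenspace_coefficients(1)[OF q y, of k] by (simp add: algebra_simps eq_neg_iff_add_eq_0)
  ultimately show ?thesis
    using fourier_coefficients_product[OF q eigenspace_coefficients(2)[OF q y], of k] by simp
qed

section \<open>Discrete Gronwall estimates\<close>

text \<open>Iterating \<open>1 + w \<le> exp w\<close>.\<close>

lemma discrete_gronwall:
  fixes u w :: "nat \<Rightarrow> real"
  assumes step: "\<And>p. u (Suc p) \<le> (1 + w p) * u p" and w: "\<And>p. 0 \<le> w p" "summable w" and "0 \<le> u 0"
  shows "u p \<le> exp (suminf w) * u 0"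
proof -
  have "u p \<le> exp (\<Sum>i<p. w i) * u 0"
  proof (induction p)
    case (Suc p)
    have "u (Suc p) \<le> (1 + w p) * u p" by (rule step)
    also have "\<dots> \<le> (1 + w p) * (exp (\<Sum>i<p. w i) * u 0)"
      using Suc w(1)[of p] by (intro mult_left_mono) auto
    also have "\<dots> \<le> exp (w p) * (exp (\<Sum>i<p. w i) * u 0)"
      using \<open>0 \<le> u 0\<close> by (intro mult_right_mono) auto
    finally show ?case by (simp add: exp_add mult_ac)
  qed simp
  also have "\<dots> \<le> exp (suminf w) * u 0"
    using sum_le_suminf[OF w(2), of "{..<p}"] w(1) \<open>0 \<le> u 0\<close> by (intro mult_right_mono) auto
  finally show ?thesis .
qed

text \<open>The Gronwall argument run from infinity. The tails \<open>s p\<close> of the sum of \<open>u\<close> satisfy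
\<open>s p \<le> (1 + w p) * s (Suc p)\<close>, so \<open>s 0\<close> is at most a fixed multiple of \<open>s N\<close>
for every \<open>N\<close>; but \<open>s N\<close> tends to zero.\<close>

lemma summable_dominated_by_tail_eq_0:
  fixes u w :: "nat \<Rightarrow> real"
  assumes u: "\<And>p. 0 \<le> u p" "summable u" and w: "\<And>p. 0 \<le> w p" "summable w"
    and tail: "\<And>p. u p \<le> w p * (\<Sum>i. u (i + Suc p))"
  shows "u p = 0"
proof -
  define s where "s p = (\<Sum>i. u (i + p))" for p
  have s_nonneg: "0 \<le> s p" for p
    unfolding s_def using u by (intro suminf_nonneg summable_ignore_initial_segment) auto
  have s_eq: "s p = suminf u - (\<Sum>i<p. u i)" for p
    unfolding s_def by (rule suminf_minus_initial_segment[OF u(2)])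
  have step: "s p \<le> (1 + w p) * s (Suc p)" for p
  proof -
    have "s p = u p + s (Suc p)"
      using s_eq[of p] s_eq[of "Suc p"] by simp
    moreover have "u p \<le> w p * s (Suc p)"
      using tail[of p] by (simp only: s_def)
    ultimately show ?thesis by (simp add: algebra_simps)
  qed
  have bound: "s 0 \<le> exp (suminf w) * s N" for N
  proof -
    have "s 0 \<le> exp (\<Sum>i<N. w i) * s N"
    proof (induction N)
      case (Suc N)
      note Suc
      also have "exp (\<Sum>i<N. w i) * s N \<le> exp (\<Sum>i<N. w i) * ((1 + w N) * s (Suc N))"
        by (intro mult_left_mono step) simp
      also have "\<dots> \<le> exp (\<Sum>i<N. w i) * (exp (w N) * s (Suc N))"
        by (intro mult_left_mono mult_right_mono s_nonneg) auto
      finally show ?case by (simp add: exp_add mult_ac)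
    qed simp
    also have "\<dots> \<le> exp (suminf w) * s N"
      using sum_le_suminf[OF w(2), of "{..<N}"] w(1) s_nonneg by (intro mult_right_mono) auto
    finally show ?thesis .
  qed
  have "s \<longlonglongrightarrow> suminf u - suminf u"
    unfolding s_eq[abs_def] by (intro tendsto_intros summable_LIMSEQ u)
  then have "(\<lambda>N. exp (suminf w) * s N) \<longlonglongrightarrow> exp (suminf w) * 0"
    by (intro tendsto_intros) simp
  then have "s 0 \<le> exp (suminf w) * 0"
    by (rule LIMSEQ_le_const) (use bound in blast)
  then have "suminf u = 0"
    using s_nonneg[of 0] by (simp add: s_def)
  then show ?thesis
    using u by (simp add: suminf_eq_zero_iff)
qed

section \<open>Triangular recurrences\<close>

text \<open>Forward substitution for \<open>\<mu> k * a k + (\<Sum>j<k. Q (k - j) * a j) = b k\<close>, started at the index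
\<open>m\<close>. Where \<open>\<mu>\<close> vanishes the equation does not determine the unknown, and the value is
taken from \<open>v\<close>.\<close>

function triangular_solution ::
  "(int \<Rightarrow> complex) \<Rightarrow> (int \<Rightarrow> complex) \<Rightarrow> (int \<Rightarrow> complex) \<Rightarrow> (int \<Rightarrow> complex) \<Rightarrow> int \<Rightarrow> int \<Rightarrow> complex"
where
  "triangular_solution \<mu> Q v b m k =
     (if k < m then 0
      else if \<mu> k = 0 then v k
      else (b k - (\<Sum>j\<in>{m..<k}. Q (k - j) * triangular_solution \<mu> Q v b m j)) / \<mu> k)"
  by pat_completeness auto
termination
  by (relation "Wellfounded.measure (\<lambda>(\<mu>, Q, v, b, m, k). nat (k - m + 1))") auto

declare triangular_solution.simps [simp del]

text \<open>If each term is at most \<open>C / p\<^sup>2\<close> times one plus the sum of all earlier terms, then Gronwall's estimate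
bounds the partial sums. This gives convergence of the series constructed by forward substitution.\<close>

lemma int_majorized_summable:
  fixes a :: "int \<Rightarrow> complex" and n m :: int
  assumes low: "\<And>j. j < m \<Longrightarrow> a j = 0" and "m \<le> n + 1"
    and C: "0 \<le> C"
    and step: "\<And>p. norm (a (n + 1 + int p)) \<le> C * (1 / real (Suc p) ^ 2) * (1 + (\<Sum>j\<in>{m..<n + 1 + int p}. norm (a j)))"
  shows "(\<lambda>j. norm (a j)) summable_on UNIV"
proof -
  define w where "w p = C * (1 / real (Suc p) ^ 2)" for p
  define u where "u p = 1 + (\<Sum>j\<in>{m..<n + 1 + int p}. norm (a j))" for p
  have w: "0 \<le> w p" for p using C by (simp add: w_def)
  have ws: "summable w"
    unfolding w_def using inverse_power_summable[of 2, where 'a=real, THEN summable_Suc_iff[THEN iffD2]]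
    by (intro summable_mult) (simp add: inverse_eq_divide)
  \<comment> \<open>The constant 1 absorbs a bounded inhomogeneity into the homogeneous estimate.\<close>
  have u_le: "u p \<le> exp (suminf w) * u 0" for p
  proof (rule discrete_gronwall[OF _ w ws])
    fix p
    have "{m..<n + 1 + int (Suc p)} = insert (n + 1 + int p) {m..<n + 1 + int p}"
      using \<open>m \<le> n + 1\<close> by auto
    then have "u (Suc p) = u p + norm (a (n + 1 + int p))"
      by (simp add: u_def)
    moreover have "norm (a (n + 1 + int p)) \<le> w p * u p"
      unfolding w_def u_def by (rule step)
    ultimately show "u (Suc p) \<le> (1 + w p) * u p"
      by (simp add: algebra_simps)
  qed (simp add: u_def sum_nonneg)
  show ?thesis
  proof (rule nonneg_bdd_above_summable_on)
    show "bdd_above (sum (\<lambda>j. norm (a j)) ` {F. F \<subseteq> UNIV \<and> finite F})"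
    proof (rule bdd_aboveI2)
      fix F :: "int set" assume "F \<in> {F. F \<subseteq> UNIV \<and> finite F}"
      then have "finite F" by simp
      then obtain c where c: "\<And>j. j \<in> F \<Longrightarrow> j \<le> c"
        using bdd_above_finite[of F] by (auto simp: bdd_above_def)
      have "(\<Sum>j\<in>F. norm (a j)) = (\<Sum>j\<in>F \<inter> {m..}. norm (a j))"
        using \<open>finite F\<close> low by (intro sum.mono_neutral_right) (auto simp: not_le)
      also have "\<dots> \<le> (\<Sum>j\<in>{m..<n + 1 + int (nat (c - n))}. norm (a j))"
        using c by (intro sum_mono2) force+
      also have "\<dots> \<le> exp (suminf w) * u 0"
        using u_le[of "nat (c - n)"] by (simp add: u_def)
      finally show "(\<Sum>j\<in>F. norm (a j)) \<le> exp (suminf w) * u 0" .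
    qed
  qed simp
qed

section \<open>The eigenspace in terms of Fourier coefficients\<close>

text \<open>Elements of the domain of \<open>L0\<close> are represented by functions that vanish off the unit interval.\<close>

definition trig_extension :: "(int \<Rightarrow> complex) \<Rightarrow> real \<Rightarrow> complex" where
  "trig_extension a x = (if x \<in> {0..1} then trig_series a x else 0)"

lemma continuous_on_trig_extension:
  assumes "(\<lambda>j. norm (a j)) summable_on UNIV"
  shows "continuous_on {0..1} (trig_extension a)"
  using continuous_on_trig_series[OF assms, of "{0..1}"]
  by (rule continuous_on_eq) (simp add: trig_extension_def)

lemma fourier_coefficients_trig_extension:
  assumes "(\<lambda>j. norm (a j)) summable_on UNIV"
  shows "ip01 (trig_extension a) (expi k) = a k"
proof -
  have "ip01 (trig_extension a) (expi k) = ip01 (trig_series a) (expi k)"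
    by (rule ip01_cong) (simp add: trig_extension_def)
  then show ?thesis
    using fourier_coefficients_trig_series[OF assms] by simp
qed

text \<open>Together with \<open>eigenspace_coefficients\<close> this characterises the eigenspace by conditions that are
linear in the Fourier coefficients.\<close>

lemma eigenspaceI:
  fixes l :: complex
  assumes q: "integrable I01 q"
    and y: "continuous_on {0..1} y" "y 1 = y 0" "\<And>x. x \<notin> {0..1} \<Longrightarrow> y x = 0"
    and sum: "(\<lambda>k. norm (ip01 y (expi k))) summable_on UNIV"
    and eq: "\<And>k. ((2 * pi * of_int k)\<^sup>2 - l) * ip01 y (expi k) + ip01 (\<lambda>x. q x * y x) (expi k) = 0"
  shows "y \<in> eigenspace q l"
proof -
  have yi: "integrable I01 y" and qyi: "integrable I01 (\<lambda>x. q x * y x)"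
    using q y(1) by (auto intro: integrable_01_continuous integrable_mult_continuous)
  have "L0 q y (\<lambda>x. l * y x)"
  proof (rule L0_trig_series[OF sum])
    show "integrable I01 (\<lambda>x. 1 * (q x * y x) + (-l) * y x)"
      using yi qyi by simp
    show "ip01 (\<lambda>x. 1 * (q x * y x) + (-l) * y x) (expi k) = - ((2 * pi * of_int k)\<^sup>2) * ip01 y (expi k)" for k
      using eq[of k] by (subst ip01_lincomb[OF qyi yi]) (simp add: algebra_simps add_eq_0_iff)
    show "y x = (if x \<in> {0..1} then trig_series (\<lambda>k. ip01 y (expi k)) x else 0)" for x
      using trig_series_of_fourier_coefficients[OF y(1) y(2)[symmetric] sum] y(3) by simp
    show "(\<lambda>x. l * y x) \<in> L2_01"
      using y(1) by (intro continuous_imp_L2_01 continuous_intros)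
  qed simp
  then show ?thesis by (simp add: eigenspace_def)
qed

lemma eigenspace_lincomb:
  assumes q: "integrable I01 q" and y: "y \<in> eigenspace q l" "z \<in> eigenspace q l"
  shows "(\<lambda>x. a * y x + b * z x) \<in> eigenspace q l"
proof (rule eigenspaceI[OF q])
  note cont = eigenspace_continuous[OF y(1)] eigenspace_continuous[OF y(2)]
  have i: "integrable I01 y" "integrable I01 z" "integrable I01 (\<lambda>x. q x * y x)" "integrable I01 (\<lambda>x. q x * z x)"
    using q cont by (auto intro: integrable_01_continuous integrable_mult_continuous)
  show "continuous_on {0..1} (\<lambda>x. a * y x + b * z x)"
    using cont by (intro continuous_intros)
  show "a * y 1 + b * z 1 = a * y 0 + b * z 0"
    using cont by simp
  show "a * y x + b * z x = 0" if "x \<notin> {0..1}" for x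
    using cont that by simp
  have coeff: "ip01 (\<lambda>x. a * y x + b * z x) (expi k) = a * ip01 y (expi k) + b * ip01 z (expi k)" for k
    using i by (intro ip01_lincomb)
  have "(\<lambda>k. norm a * norm (ip01 y (expi k)) + norm b * norm (ip01 z (expi k))) summable_on UNIV"
    using eigenspace_coefficients(2)[OF q] y by (intro summable_on_add summable_on_cmult_right)
  then show "(\<lambda>k. norm (ip01 (\<lambda>x. a * y x + b * z x) (expi k))) summable_on UNIV"
    by (rule summable_on_comparison_test)
      (auto simp: coeff norm_mult[symmetric] norm_triangle_ineq)
  fix k
  have "ip01 (\<lambda>x. q x * (a * y x + b * z x)) (expi k) = ip01 (\<lambda>x. a * (q x * y x) + b * (q x * z x)) (expi k)"
    by (rule ip01_cong) (simp add: algebra_simps)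
  also have "\<dots> = a * ip01 (\<lambda>x. q x * y x) (expi k) + b * ip01 (\<lambda>x. q x * z x) (expi k)"
    using i by (intro ip01_lincomb)
  finally have "((2 * pi * of_int k)\<^sup>2 - l) * ip01 (\<lambda>x. a * y x + b * z x) (expi k)
      + ip01 (\<lambda>x. q x * (a * y x + b * z x)) (expi k)
    = a * (((2 * pi * of_int k)\<^sup>2 - l) * ip01 y (expi k) + ip01 (\<lambda>x. q x * y x) (expi k))
      + b * (((2 * pi * of_int k)\<^sup>2 - l) * ip01 z (expi k) + ip01 (\<lambda>x. q x * z x) (expi k))"
    by (simp add: coeff algebra_simps)
  then show "((2 * pi * of_int k)\<^sup>2 - l) * ip01 (\<lambda>x. a * y x + b * z x) (expi k)
      + ip01 (\<lambda>x. q x * (a * y x + b * z x)) (expi k) = 0"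
    using eigenspace_coefficients(1)[OF q] y by simp
qed

section \<open>The triangular recurrence\<close>

text \<open>In this context \<open>lam\<close> is the eigenvalue
\<open>(2 \<pi> n)\<^sup>2\<close> and \<open>symb k\<close> is the symbol of \<open>-y'' - lam y\<close> at the frequency \<open>k\<close>; its
zeros \<open>\<plusminus>n\<close> are called resonances.\<close>

locale one_sided_potential =
  fixes q :: "real \<Rightarrow> complex" and n :: nat
  assumes q_integrable: "integrable I01 q"
    and q_coeff_nonpos: "\<And>k. k \<le> 0 \<Longrightarrow> ip01 q (expi k) = 0"
    and n_pos: "1 \<le> n"
begin

abbreviation Q :: "int \<Rightarrow> complex" where
  "Q k \<equiv> ip01 q (expi k)"

definition lam :: complex where
  "lam = complex_of_real ((2 * pi * real n)\<^sup>2)"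

definition symb :: "int \<Rightarrow> complex" where
  "symb k = (2 * pi * of_int k)\<^sup>2 - lam"

definition q_norm :: real where
  "q_norm = (\<integral>x. norm (q x) \<partial>I01)"

lemma q_norm_nonneg: "0 \<le> q_norm"
  by (simp add: q_norm_def)

lemma norm_Q_le: "norm (Q k) \<le> q_norm"
  unfolding q_norm_def by (rule norm_ip01_expi_le)

lemma symb_eq: "symb k = of_real ((2 * pi)\<^sup>2 * of_int (k\<^sup>2 - (int n)\<^sup>2))"
  by (simp add: symb_def lam_def algebra_simps power_mult_distrib)

lemma symb_eq_0_iff: "symb k = 0 \<longleftrightarrow> k = int n \<or> k = - int n"
  unfolding symb_eq of_real_eq_0_iff mult_eq_0_iff of_int_eq_0_iff
  by (auto simp: power2_eq_iff)

text \<open>Beyond the resonances the symbol grows at least quadratically in the distance \<open>p + 1\<close> to the nearer one.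
Its reciprocal is thus a summable weight for the two Gronwall arguments.\<close>

lemma norm_symb_ge:
  assumes "\<bar>k\<bar> = int n + 1 + int p"
  shows "real (Suc p) ^ 2 \<le> norm (symb k)"
proof -
  have "k\<^sup>2 = (int n + 1 + int p)\<^sup>2"
    using assms by (metis power2_abs)
  then have "k\<^sup>2 - (int n)\<^sup>2 = (int (Suc p))\<^sup>2 + 2 * int n * int (Suc p)"
    by (simp add: power2_eq_square algebra_simps)
  then have "(int (Suc p))\<^sup>2 \<le> k\<^sup>2 - (int n)\<^sup>2"
    by simp
  then have "real_of_int ((int (Suc p))\<^sup>2) \<le> of_int (k\<^sup>2 - (int n)\<^sup>2)"
    by (simp only: of_int_le_iff)
  then have 1: "real (Suc p) ^ 2 \<le> of_int (k\<^sup>2 - (int n)\<^sup>2)"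
    by simp
  have "1 \<le> 2 * pi" using pi_ge_two by simp
  then have "1 ^ 2 \<le> (2 * pi) ^ 2" by (rule power_mono) simp
  then have "1 * of_int (k\<^sup>2 - (int n)\<^sup>2) \<le> (2 * pi)\<^sup>2 * real_of_int (k\<^sup>2 - (int n)\<^sup>2)"
    using order_trans[OF zero_le_power2 1] by (intro mult_right_mono) auto
  also have "\<dots> \<le> norm (symb k)"
    unfolding symb_eq norm_of_real by (rule abs_ge_self)
  finally show ?thesis using 1 by simp
qed

lemma eigenspace_recurrence':
  assumes "y \<in> eigenspace q lam"
  shows "((\<lambda>j. ip01 y (expi j) * Q (k - j)) has_sum - symb k * ip01 y (expi k)) UNIV"
  using eigenspace_recurrence[OF q_integrable assms, of k] by (simp add: symb_def)

text \<open>Because \<open>q\<close> has positive frequencies only, multiplication by \<open>q\<close> is strictly lower triangular: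
the terms with \<open>j \<ge> k\<close> vanish, and those with \<open>j < m\<close> vanish by hypothesis.\<close>

lemma has_sum_convolution:
  assumes low: "\<And>j. j < m \<Longrightarrow> a j = 0"
  shows "((\<lambda>j. a j * Q (k - j)) has_sum (\<Sum>j\<in>{m..<k}. Q (k - j) * a j)) UNIV"
  by (rule has_sum_finite_neutralI[of "{m..<k}"])
    (use low q_coeff_nonpos in \<open>auto simp: mult.commute not_le not_less\<close>)

lemma eigenfunction_recurrence:
  assumes "y \<in> eigenspace q lam" "\<And>j. j < m \<Longrightarrow> ip01 y (expi j) = 0"
  shows "symb k * ip01 y (expi k) + (\<Sum>j\<in>{m..<k}. Q (k - j) * ip01 y (expi j)) = 0"
proof -
  have "- symb k * ip01 y (expi k) = (\<Sum>j\<in>{m..<k}. Q (k - j) * ip01 y (expi j))"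
    using eigenspace_recurrence'[OF assms(1)] by (rule has_sum_unique) (rule has_sum_convolution[OF assms(2)])
  from this[symmetric] show ?thesis by simp
qed

text \<open>Below \<open>-n\<close> each coefficient is dominated by the tail formed by the still lower ones, with a
summable factor \<open>w\<close>. No nonzero summable family can satisfy this, so the eigenfunction
has no frequencies below \<open>-n\<close>.\<close>

lemma eigenfunction_coeff_below:
  assumes y: "y \<in> eigenspace q lam" and k: "k < - int n"
  shows "ip01 y (expi k) = 0"
proof -
  define c where "c p = ip01 y (expi (- int n - 1 - int p))" for p
  define w where "w p = q_norm * (1 / real (Suc p) ^ 2)" for p
  have summable: "summable (\<lambda>p. norm (c p))"
  proof -
    have "(\<lambda>j. norm (ip01 y (expi j))) summable_on range (\<lambda>p. - int n - 1 - int p)"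
      using eigenspace_coefficients(2)[OF q_integrable y] by (rule summable_on_subset_banach) simp
    then have "(\<lambda>p. norm (c p)) summable_on UNIV"
      by (subst (asm) summable_on_reindex) (auto simp: inj_def o_def c_def)
    then show ?thesis
      by (subst (asm) summable_on_UNIV_nonneg_real_iff) auto
  qed
  have "norm (c p) = 0" for p
  proof (rule summable_dominated_by_tail_eq_0[where w = w])
    show "summable w"
      unfolding w_def using inverse_power_summable[of 2, where 'a=real, THEN summable_Suc_iff[THEN iffD2]]
      by (intro summable_mult) (simp add: inverse_eq_divide)
    show "0 \<le> w p" for p
      using q_norm_nonneg by (simp add: w_def)
    fix p
    define k where "k = - int n - 1 - int p"
    have "((\<lambda>j. ip01 y (expi j) * Q (k - j)) has_sum - symb k * ip01 y (expi k)) {..<k}"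
      using eigenspace_recurrence'[OF y, of k]
      by (rule has_sum_cong_neutral[THEN iffD1, rotated -1]) (auto simp: q_coeff_nonpos)
    moreover have "bij_betw (\<lambda>i. - int n - 1 - int (i + Suc p)) UNIV {..<k}"
      by (rule bij_betwI[where g = "\<lambda>j. nat (- int n - 1 - j) - Suc p"]) (auto simp: k_def)
    ultimately have "((\<lambda>i. c (i + Suc p) * Q (k - (- int n - 1 - int (i + Suc p)))) has_sum - symb k * c p) UNIV"
      unfolding c_def k_def[symmetric] by (subst (asm) has_sum_reindex_bij_betw[symmetric])
    then have sums: "(\<lambda>i. c (i + Suc p) * Q (k - (- int n - 1 - int (i + Suc p)))) sums (- symb k * c p)"
      by (rule has_sum_imp_sums)
    have tail: "summable (\<lambda>i. norm (c (i + Suc p)))"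
      using summable by (rule summable_ignore_initial_segment)
    have "norm (- symb k * c p) \<le> (\<Sum>i. q_norm * norm (c (i + Suc p)))"
      unfolding sums_unique[OF sums]
    proof (rule norm_suminf_le)
      show "norm (c (i + Suc p) * Q (k - (- int n - 1 - int (i + Suc p)))) \<le> q_norm * norm (c (i + Suc p))" for i
        using norm_Q_le by (simp add: norm_mult mult.commute[of q_norm] mult_left_mono)
    qed (intro summable_mult tail)
    also have "\<dots> = q_norm * (\<Sum>i. norm (c (i + Suc p)))"
      using tail by (rule suminf_mult)
    finally have "norm (symb k) * norm (c p) \<le> q_norm * (\<Sum>i. norm (c (i + Suc p)))"
      by (simp add: norm_mult)
    moreover have "real (Suc p) ^ 2 * norm (c p) \<le> norm (symb k) * norm (c p)"
      by (intro mult_right_mono norm_symb_ge) (auto simp: k_def)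
    ultimately have "real (Suc p) ^ 2 * norm (c p) \<le> q_norm * (\<Sum>i. norm (c (i + Suc p)))"
      by simp
    then show "norm (c p) \<le> w p * (\<Sum>i. norm (c (i + Suc p)))"
      by (simp add: w_def field_simps del: of_nat_Suc)
  qed (use summable in auto)
  from this[of "nat (- int n - 1 - k)"] show ?thesis
    using k by (simp add: c_def)
qed

text \<open>Starting from the vanishing below \<open>-n\<close>, the triangular recurrence propagates zero coefficients upward;
only a resonance can interrupt this.\<close>

lemma eigenfunction_coeff_vanish:
  assumes y: "y \<in> eigenspace q lam"
    and res: "\<And>j. j < m \<Longrightarrow> symb j = 0 \<Longrightarrow> ip01 y (expi j) = 0"
    and k: "k < m"
  shows "ip01 y (expi k) = 0"
proof -
  have "\<forall>k < - int n + int i. k < m \<longrightarrow> ip01 y (expi k) = 0" for i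
  proof (induction i)
    case 0
    then show ?case using eigenfunction_coeff_below[OF y] by simp
  next
    case (Suc i)
    define k where "k = - int n + int i"
    have "ip01 y (expi k) = 0" if "k < m"
    proof (cases "symb k = 0")
      case True
      then show ?thesis using res that by blast
    next
      case False
      have "symb k * ip01 y (expi k) + (\<Sum>j\<in>{k..<k}. Q (k - j) * ip01 y (expi j)) = 0"
        using Suc that by (intro eigenfunction_recurrence[OF y]) (auto simp: k_def)
      then show ?thesis using False by simp
    qed
    moreover have "j < - int n + int i \<or> j = k" if "j < - int n + int (Suc i)" for j
      using that by (auto simp: k_def)
    ultimately show ?case using Suc by blast
  qed
  from this[of "nat (k + int n + 1)"] show ?thesis using k by simp
qed

lemma eigenfunction_has_form:
  assumes y: "y \<in> eigenspace q lam" and low: "\<And>j. j < m \<Longrightarrow> ip01 y (expi j) = 0"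
    and lead: "ip01 y (expi m) \<noteq> 0"
  shows "has_form m (\<lambda>x. y x / ip01 y (expi m))"
proof (rule has_form_trig_series[where a = "\<lambda>j. ip01 y (expi j) / ip01 y (expi m)"])
  have "(\<lambda>j. norm (ip01 y (expi j)) * (1 / norm (ip01 y (expi m)))) summable_on UNIV"
    using eigenspace_coefficients(2)[OF q_integrable y] by (rule summable_on_cmult_left)
  then show "(\<lambda>j. norm (ip01 y (expi j) / ip01 y (expi m))) summable_on UNIV"
    by (simp add: norm_divide)
  show "y x / ip01 y (expi m) = trig_series (\<lambda>j. ip01 y (expi j) / ip01 y (expi m)) x" if "x \<in> {0..1}" for x
  proof -
    have "trig_series (\<lambda>j. ip01 y (expi j) / ip01 y (expi m)) x
        = (\<Sum>\<^sub>\<infinity>j. ip01 y (expi j) * expi j x * (1 / ip01 y (expi m)))"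
      by (simp add: trig_series_def)
    also have "\<dots> = trig_series (\<lambda>j. ip01 y (expi j)) x * (1 / ip01 y (expi m))"
      unfolding trig_series_def by (rule infsum_cmult_left')
    finally show ?thesis
      using eigenspace_trig_series[OF q_integrable y that] by simp
  qed
qed (use low lead in auto)

text \<open>The first resonance with a nonzero coefficient is the lowest frequency of the eigenfunction. If
both resonant coefficients vanish, all coefficients do.\<close>

lemma eigenfunction_form:
  assumes y: "y \<in> eigenspace q lam"
  shows "ip01 y (expi (- int n)) \<noteq> 0 \<Longrightarrow> has_form_up_to_constant (- int n) y"
    and "ip01 y (expi (- int n)) = 0 \<Longrightarrow> ip01 y (expi (int n)) \<noteq> 0 \<Longrightarrow> has_form_up_to_constant (int n) y"
    and "ip01 y (expi (- int n)) = 0 \<Longrightarrow> ip01 y (expi (int n)) = 0 \<Longrightarrow> y = (\<lambda>x. 0)"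
proof -
  have form: "has_form_up_to_constant m y"
    if "\<And>j. j < m \<Longrightarrow> symb j = 0 \<Longrightarrow> ip01 y (expi j) = 0" "ip01 y (expi m) \<noteq> 0" for m
    unfolding has_form_up_to_constant_def
    using eigenfunction_has_form[OF y eigenfunction_coeff_vanish[OF y that(1)]] that(2)
    by (intro exI[of _ "ip01 y (expi m)"] exI[of _ "\<lambda>x. y x / ip01 y (expi m)"]) auto
  show "ip01 y (expi (- int n)) \<noteq> 0 \<Longrightarrow> has_form_up_to_constant (- int n) y"
    by (rule form) (auto simp: symb_eq_0_iff)
  show "ip01 y (expi (- int n)) = 0 \<Longrightarrow> ip01 y (expi (int n)) \<noteq> 0 \<Longrightarrow> has_form_up_to_constant (int n) y"
    by (rule form) (auto simp: symb_eq_0_iff)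
  assume zero: "ip01 y (expi (- int n)) = 0" "ip01 y (expi (int n)) = 0"
  have coeff: "ip01 y (expi k) = 0" for k
    using eigenfunction_coeff_vanish[OF y, of "k + 1" k] zero by (auto simp: symb_eq_0_iff)
  show "y = (\<lambda>x. 0)"
  proof
    fix x
    show "y x = 0"
    proof (cases "x \<in> {0..1}")
      case True
      then show ?thesis
        using eigenspace_trig_series[OF q_integrable y True] by (simp add: coeff trig_series_def)
    next
      case False
      then show ?thesis by (rule eigenspace_continuous(3)[OF y])
    qed
  qed
qed

text \<open>An absolutely summable solution of the triangular recurrence solves \<open>(L0 - lam) y = f\<close>, where \<open>f\<close>
has the coefficients on the right-hand side.\<close>

lemma L0_of_recurrence:
  assumes a: "(\<lambda>j. norm (a j)) summable_on UNIV" "\<And>j. j < m \<Longrightarrow> a j = 0"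
    and b: "(\<lambda>j. norm (b j)) summable_on UNIV" "\<And>j. j < m \<Longrightarrow> b j = 0"
    and eq: "\<And>k. m \<le> k \<Longrightarrow> symb k * a k + (\<Sum>j\<in>{m..<k}. Q (k - j) * a j) = b k"
  shows "L0 q (trig_extension a) (\<lambda>x. lam * trig_extension a x + trig_extension b x)"
proof (rule L0_trig_series[OF a(1)])
  let ?y = "trig_extension a" and ?b = "trig_extension b"
  have yc: "continuous_on {0..1} ?y" and bc: "continuous_on {0..1} ?b"
    using a(1) b(1) by (auto intro: continuous_on_trig_extension)
  have yi: "integrable I01 ?y" and bi: "integrable I01 ?b"
    using yc bc by (auto intro: integrable_01_continuous)
  have qyi: "integrable I01 (\<lambda>x. q x * ?y x)"
    using q_integrable yc by (rule integrable_mult_continuous)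
  have "integrable I01 (\<lambda>x. lam * ?y x + 1 * ?b x)"
    using yi bi by simp
  note i = qyi this yi bi
  show "integrable I01 (\<lambda>x. 1 * (q x * ?y x) + (-1) * (lam * ?y x + 1 * ?b x))"
    using qyi yi bi by simp
  fix k
  have conv: "ip01 (\<lambda>x. q x * ?y x) (expi k) = (\<Sum>j\<in>{m..<k}. Q (k - j) * a j)"
  proof -
    have "ip01 (\<lambda>x. q x * ?y x) (expi k) = ip01 (\<lambda>x. q x * trig_series a x) (expi k)"
      by (rule ip01_cong) (simp add: trig_extension_def)
    also have "\<dots> = (\<Sum>j\<in>{m..<k}. Q (k - j) * a j)"
      using fourier_coefficients_product[OF q_integrable a(1)] has_sum_convolution[OF a(2)]
      by (rule has_sum_unique)
    finally show ?thesis .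
  qed
  have rec: "b k = symb k * a k + (\<Sum>j\<in>{m..<k}. Q (k - j) * a j)"
    using eq[of k] a(2)[of k] b(2)[of k] by (cases "m \<le> k") auto
  have "ip01 (\<lambda>x. 1 * (q x * ?y x) + (-1) * (lam * ?y x + 1 * ?b x)) (expi k)
      = 1 * ip01 (\<lambda>x. q x * ?y x) (expi k) + (-1) * (lam * ip01 ?y (expi k) + 1 * ip01 ?b (expi k))"
    using i by (simp only: ip01_lincomb)
  also have "\<dots> = (\<Sum>j\<in>{m..<k}. Q (k - j) * a j) - (lam * a k + b k)"
    using a(1) b(1) by (simp add: fourier_coefficients_trig_extension conv)
  also have "\<dots> = - ((2 * pi * of_int k)\<^sup>2) * a k"
    unfolding rec symb_def by (simp add: algebra_simps)
  finally show "ip01 (\<lambda>x. 1 * (q x * ?y x) + (-1) * (lam * ?y x + 1 * ?b x)) (expi k)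
      = - ((2 * pi * of_int k)\<^sup>2) * a k" .
next
  show "(\<lambda>x. lam * trig_extension a x + trig_extension b x) \<in> L2_01"
    using a(1) b(1) by (intro continuous_imp_L2_01 continuous_intros continuous_on_trig_extension)
  show "AE x in I01. lam * trig_extension a x + trig_extension b x
      = - (1 * (q x * trig_extension a x) + (-1) * (lam * trig_extension a x + 1 * trig_extension b x))
        + q x * trig_extension a x"
    by simp
qed (simp add: trig_extension_def)

text \<open>For a bounded right-hand side, forward substitution from \<open>m \<le> n\<close> yields an absolutely summable solution,
with the values at the resonances prescribed at will; the equations at the resonances are not asserted.\<close>

lemma recurrence_solution:
  assumes "m \<le> int n" and b: "\<And>k. norm (b k) \<le> B"
  obtains a where "\<And>j. j < m \<Longrightarrow> a j = 0" "\<And>k. m \<le> k \<Longrightarrow> symb k = 0 \<Longrightarrow> a k = v k"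
    "\<And>k. m \<le> k \<Longrightarrow> symb k \<noteq> 0 \<Longrightarrow> symb k * a k + (\<Sum>j\<in>{m..<k}. Q (k - j) * a j) = b k"
    "(\<lambda>j. norm (a j)) summable_on UNIV"
proof -
  define a where "a = triangular_solution symb Q v b m"
  have low: "a j = 0" if "j < m" for j
    using that by (simp add: a_def triangular_solution.simps)
  have res: "a k = v k" if "m \<le> k" "symb k = 0" for k
    using that by (simp add: a_def triangular_solution.simps)
  have rec: "symb k * a k + (\<Sum>j\<in>{m..<k}. Q (k - j) * a j) = b k" if "m \<le> k" "symb k \<noteq> 0" for k
    using that unfolding a_def by (subst triangular_solution.simps) simp
  have "(\<lambda>j. norm (a j)) summable_on UNIV"
  proof (rule int_majorized_summable[OF low])
    show "m \<le> int n + 1" using assms(1) by simp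
    show "0 \<le> max q_norm B" using q_norm_nonneg by simp
    fix p
    define k where "k = int n + 1 + int p"
    define T where "T = (\<Sum>j\<in>{m..<k}. norm (a j))"
    have "T \<ge> 0" by (simp add: T_def sum_nonneg)
    have "real (Suc p) ^ 2 * norm (a k) \<le> norm (symb k) * norm (a k)"
      by (intro mult_right_mono norm_symb_ge) (auto simp: k_def)
    also have "\<dots> = norm (b k - (\<Sum>j\<in>{m..<k}. Q (k - j) * a j))"
    proof -
      have "symb k * a k = b k - (\<Sum>j\<in>{m..<k}. Q (k - j) * a j)"
        using rec[of k] assms(1) by (simp add: k_def symb_eq_0_iff eq_diff_eq)
      then show ?thesis by (metis norm_mult)
    qed
    also have "\<dots> \<le> norm (b k) + norm (\<Sum>j\<in>{m..<k}. Q (k - j) * a j)"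
      by (rule norm_triangle_ineq4)
    also have "\<dots> \<le> B + q_norm * T"
    proof (intro add_mono b)
      show "norm (\<Sum>j\<in>{m..<k}. Q (k - j) * a j) \<le> q_norm * T"
        unfolding T_def sum_distrib_left
        by (rule sum_norm_le) (simp add: norm_mult mult_right_mono norm_Q_le)
    qed
    also have "\<dots> \<le> max q_norm B * 1 + max q_norm B * T"
      using \<open>T \<ge> 0\<close> by (intro add_mono mult_right_mono) auto
    finally show "norm (a (int n + 1 + int p)) \<le> max q_norm B * (1 / real (Suc p) ^ 2)
        * (1 + (\<Sum>j\<in>{m..<int n + 1 + int p}. norm (a j)))"
      unfolding T_def[symmetric] k_def[symmetric] by (simp add: field_simps del: of_nat_Suc)
  qed
  then show thesis using that low res rec by blast
qed

text \<open>A solution started at the upper resonance \<open>n\<close> meets no further resonance, and at \<open>n\<close> itself the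
equation is trivial. So an eigenfunction with lowest frequency \<open>n\<close> always exists.\<close>

lemma upper_eigenfunction_coefficients:
  obtains a where "\<And>j. j < int n \<Longrightarrow> a j = 0" "a (int n) = 1" "(\<lambda>j. norm (a j)) summable_on UNIV"
    "\<And>k. int n \<le> k \<Longrightarrow> symb k * a k + (\<Sum>j\<in>{int n..<k}. Q (k - j) * a j) = 0"
proof -
  obtain a where a: "\<And>j. j < int n \<Longrightarrow> a j = 0" "\<And>k. int n \<le> k \<Longrightarrow> symb k = 0 \<Longrightarrow> a k = 1"
    "\<And>k. int n \<le> k \<Longrightarrow> symb k \<noteq> 0 \<Longrightarrow> symb k * a k + (\<Sum>j\<in>{int n..<k}. Q (k - j) * a j) = 0"
    "(\<lambda>j. norm (a j)) summable_on UNIV"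
    by (rule recurrence_solution[of "int n" "\<lambda>_. 0" 0 "\<lambda>_. 1"]) auto
  show thesis
  proof (rule that)
    show "a (int n) = 1" by (intro a(2)) (auto simp: symb_eq_0_iff)
    show "symb k * a k + (\<Sum>j\<in>{int n..<k}. Q (k - j) * a j) = 0" if "int n \<le> k" for k
    proof (cases "symb k = 0")
      case True
      then have "k = int n" using that n_pos by (auto simp: symb_eq_0_iff)
      then show ?thesis using True by simp
    qed (use a(3) that in auto)
  qed (use a in auto)
qed

lemma eigenspace_recurrenceI:
  assumes "(\<lambda>j. norm (a j)) summable_on UNIV" "\<And>j. j < m \<Longrightarrow> a j = 0"
    and "\<And>k. m \<le> k \<Longrightarrow> symb k * a k + (\<Sum>j\<in>{m..<k}. Q (k - j) * a j) = 0"
  shows "trig_extension a \<in> eigenspace q lam"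
proof -
  have "L0 q (trig_extension a) (\<lambda>x. lam * trig_extension a x + trig_extension (\<lambda>_. 0) x)"
    by (rule L0_of_recurrence[OF assms(1,2)]) (use assms(3) in auto)
  moreover have "trig_extension (\<lambda>_. 0) x = 0" for x
    by (simp add: trig_extension_def trig_series_def)
  ultimately show ?thesis
    by (simp add: eigenspace_def)
qed

text \<open>A solution started at \<open>-n\<close> has to cross the resonance \<open>n\<close>, where the equation
fails by a defect \<open>c\<close>: the function \<open>a\<close> below satisfies \<open>(L0 - lam) a = c e\<^sub>n\<close>, with
\<open>e\<^sub>n\<close> the exponential of frequency \<open>n\<close>. Replacing \<open>e\<^sub>n\<close> by the eigenfunction
\<open>\<psi>\<close> changes the right-hand side above \<open>n\<close> only, and the correction \<open>d\<close> is supported there.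
So \<open>a + d\<close> is an eigenfunction if \<open>c = 0\<close> and an associated function otherwise.\<close>

lemma lower_chain_coefficients:
  assumes \<psi>: "\<And>j. j < int n \<Longrightarrow> \<psi> j = 0" "\<psi> (int n) = 1" "(\<lambda>j. norm (\<psi> j)) summable_on UNIV"
  obtains a c where "\<forall>j. j < - int n \<longrightarrow> a j = 0" "a (- int n) = 1"
    "(\<lambda>j. norm (a j)) summable_on UNIV"
    "\<forall>k. - int n \<le> k \<longrightarrow> symb k * a k + (\<Sum>j\<in>{- int n..<k}. Q (k - j) * a j) = c * \<psi> k"
proof -
  define v where "v k = (if k = - int n then 1 else 0 :: complex)" for k
  obtain a where a: "\<And>j. j < - int n \<Longrightarrow> a j = 0" "\<And>k. - int n \<le> k \<Longrightarrow> symb k = 0 \<Longrightarrow> a k = v k"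
    "\<And>k. - int n \<le> k \<Longrightarrow> symb k \<noteq> 0 \<Longrightarrow> symb k * a k + (\<Sum>j\<in>{- int n..<k}. Q (k - j) * a j) = 0"
    "(\<lambda>j. norm (a j)) summable_on UNIV"
    by (rule recurrence_solution[of "- int n" "\<lambda>_. 0" 0 v]) auto
  define c where "c = (\<Sum>j\<in>{- int n..<int n}. Q (int n - j) * a j)"
  define B where "B = norm c * (\<Sum>\<^sub>\<infinity>j. norm (\<psi> j))"
  have B: "norm (c * \<psi> k) \<le> B" for k
  proof -
    have "(\<Sum>j\<in>{k}. norm (\<psi> j)) \<le> (\<Sum>\<^sub>\<infinity>j. norm (\<psi> j))"
      by (rule finite_sum_le_infsum[OF \<psi>(3)]) auto
    then show ?thesis by (simp add: B_def norm_mult mult_left_mono)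
  qed
  obtain d where d: "\<And>j. j < int n \<Longrightarrow> d j = 0" "\<And>k. int n \<le> k \<Longrightarrow> symb k = 0 \<Longrightarrow> d k = 0"
    "\<And>k. int n \<le> k \<Longrightarrow> symb k \<noteq> 0 \<Longrightarrow> symb k * d k + (\<Sum>j\<in>{int n..<k}. Q (k - j) * d j) = c * \<psi> k"
    "(\<lambda>j. norm (d j)) summable_on UNIV"
    by (rule recurrence_solution[of "int n" "\<lambda>k. c * \<psi> k" B "\<lambda>_. 0"]) (use B in auto)
  have sum_d: "(\<Sum>j\<in>{- int n..<k}. Q (k - j) * d j) = (\<Sum>j\<in>{int n..<k}. Q (k - j) * d j)" for k
    by (rule sum.mono_neutral_right) (use d(1) in auto)
  show thesis
  proof (rule that; (intro allI impI)?)
    show "a j + d j = 0" if "j < - int n" for j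
      using a(1)[OF that] d(1)[of j] that by simp
    show "a (- int n) + d (- int n) = 1"
      using a(2)[of "- int n"] d(1)[of "- int n"] n_pos by (simp add: v_def symb_eq_0_iff)
    have "(\<lambda>j. norm (a j) + norm (d j)) summable_on UNIV"
      using a(4) d(4) by (rule summable_on_add)
    then show "(\<lambda>j. norm (a j + d j)) summable_on UNIV"
      by (rule summable_on_comparison_test) (auto intro: norm_triangle_ineq)
    fix k assume k: "- int n \<le> k"
    have split: "symb k * (a k + d k) + (\<Sum>j\<in>{- int n..<k}. Q (k - j) * (a j + d j))
      = (symb k * a k + (\<Sum>j\<in>{- int n..<k}. Q (k - j) * a j))
        + (symb k * d k + (\<Sum>j\<in>{int n..<k}. Q (k - j) * d j))"
      unfolding sum_d[symmetric] by (simp add: algebra_simps sum.distrib)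
    show "symb k * (a k + d k) + (\<Sum>j\<in>{- int n..<k}. Q (k - j) * (a j + d j)) = c * \<psi> k"
    proof (cases "symb k = 0")
      case False
      then have 1: "symb k * a k + (\<Sum>j\<in>{- int n..<k}. Q (k - j) * a j) = 0"
        using a(3) k by blast
      show ?thesis
      proof (cases "int n \<le> k")
        case True
        then show ?thesis unfolding split 1 using d(3) False by simp
      next
        case k': False
        then show ?thesis unfolding split 1 using d(1)[of k] \<psi>(1)[of k] by simp
      qed
    next
      case True
      then consider "k = - int n" | "k = int n" by (auto simp: symb_eq_0_iff)
      then show ?thesis
      proof cases
        case 1
        then show ?thesis using True \<psi>(1)[of k] n_pos by simp
      next
        case 2
        then show ?thesis unfolding split using True \<psi>(2) by (simp add: c_def)
      qed
    qed
  qed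
qed

section \<open>Eigenfunctions and associated functions\<close>

lemma trig_extension_has_form:
  assumes "(\<lambda>j. norm (a j)) summable_on UNIV" "\<And>j. j < m \<Longrightarrow> a j = 0" "a m = 1"
  shows "has_form m (trig_extension a)"
  by (rule has_form_trig_series[OF assms]) (simp_all add: trig_extension_def)

lemma independent_by_coefficients:
  assumes "ip01 y (expi (- int n)) = 1" "ip01 z (expi (- int n)) = 0" "ip01 z (expi (int n)) = 1"
  shows "y \<noteq> z" "cfun.independent {y, z}"
proof -
  show "y \<noteq> z" using assms by auto
  have "z \<noteq> 0" using assms(3) by (auto simp: ip01_eq zero_fun_def)
  moreover have "y \<notin> cfun.span {z}"
  proof
    assume "y \<in> cfun.span {z}"
    then obtain k where "y = (\<lambda>x. k * z x)"
      by (auto simp: cfun.span_singleton)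
    then have "ip01 y (expi (- int n)) = k * ip01 z (expi (- int n))"
      by (simp add: ip01_eq mult.assoc)
    then show False using assms by simp
  qed
  ultimately show "cfun.independent {y, z}"
    by (simp add: cfun.independent_insert)
qed

lemma upper_eigenfunction:
  obtains \<Psi> where "eigenfunction q lam \<Psi>" "has_form (int n) \<Psi>"
    "ip01 \<Psi> (expi (- int n)) = 0" "ip01 \<Psi> (expi (int n)) = 1"
proof -
  obtain a where a: "\<And>j. j < int n \<Longrightarrow> a j = 0" "a (int n) = 1" "(\<lambda>j. norm (a j)) summable_on UNIV"
    "\<And>k. int n \<le> k \<Longrightarrow> symb k * a k + (\<Sum>j\<in>{int n..<k}. Q (k - j) * a j) = 0"
    by (rule upper_eigenfunction_coefficients) blast
  note coeff = fourier_coefficients_trig_extension[OF a(3)]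
  show thesis
  proof (rule that)
    have "trig_extension a \<noteq> (\<lambda>x. 0)"
      using coeff[of "int n"] a(2) by (auto simp: ip01_eq)
    then show "eigenfunction q lam (trig_extension a)"
      using eigenspace_recurrenceI[OF a(3,1,4)] by (simp add: eigenfunction_def)
    show "has_form (int n) (trig_extension a)"
      by (rule trig_extension_has_form[OF a(3,1,2)])
  qed (use coeff a(1,2) n_pos in auto)
qed

lemma lower_eigenfunction:
  assumes y: "y \<in> eigenspace q lam" "ip01 y (expi (- int n)) \<noteq> 0"
  obtains \<Phi> where "eigenfunction q lam \<Phi>" "has_form (- int n) \<Phi>" "ip01 \<Phi> (expi (- int n)) = 1"
proof
  define c where "c = ip01 y (expi (- int n))"
  let ?\<Phi> = "\<lambda>x. y x / c"
  have i: "integrable I01 y"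
    using eigenspace_continuous(1)[OF y(1)] by (rule integrable_01_continuous)
  show coeff: "ip01 ?\<Phi> (expi (- int n)) = 1"
    using ip01_lincomb[OF i i, of "1 / c" 0] y(2) by (simp add: c_def)
  have "?\<Phi> \<in> eigenspace q lam"
    using eigenspace_lincomb[OF q_integrable y(1) y(1), of "1 / c" 0] by simp
  moreover have "?\<Phi> \<noteq> (\<lambda>x. 0)"
  proof
    assume "?\<Phi> = (\<lambda>x. 0)"
    with coeff show False by (simp add: ip01_eq)
  qed
  ultimately show "eigenfunction q lam ?\<Phi>"
    by (simp add: eigenfunction_def)
  show "has_form (- int n) ?\<Phi>"
    unfolding c_def using y by (intro eigenfunction_has_form eigenfunction_coeff_below) auto
qed

text \<open>An eigenfunction without the frequency \<open>-n\<close> is a multiple of the upper one, since the difference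
with the appropriate multiple has no resonant coefficients.\<close>

lemma geometric_multiplicity_le_1:
  assumes "\<And>y. y \<in> eigenspace q lam \<Longrightarrow> ip01 y (expi (- int n)) = 0"
  shows "geometric_multiplicity q lam \<le> 1"
proof -
  obtain \<Psi> where \<Psi>: "eigenfunction q lam \<Psi>" "ip01 \<Psi> (expi (int n)) = 1"
    by (rule upper_eigenfunction)
  have \<Psi>E: "\<Psi> \<in> eigenspace q lam" using \<Psi> by (simp add: eigenfunction_def)
  have "eigenspace q lam \<subseteq> cfun.span {\<Psi>}"
  proof
    fix y assume y: "y \<in> eigenspace q lam"
    define c where "c = ip01 y (expi (int n))"
    let ?d = "\<lambda>x. 1 * y x + (- c) * \<Psi> x"
    have d: "?d \<in> eigenspace q lam"
      by (rule eigenspace_lincomb[OF q_integrable y \<Psi>E])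
    have "ip01 ?d (expi (int n)) = 1 * ip01 y (expi (int n)) + (- c) * ip01 \<Psi> (expi (int n))"
      using eigenspace_continuous(1)[OF y] eigenspace_continuous(1)[OF \<Psi>E]
      by (intro ip01_lincomb integrable_01_continuous)
    then have "ip01 ?d (expi (int n)) = 0"
      using \<Psi>(2) by (simp add: c_def)
    then have "?d = (\<lambda>x. 0)"
      by (rule eigenfunction_form(3)[OF d assms[OF d]])
    then have "y = (\<lambda>x. c * \<Psi> x)"
      by (simp add: fun_eq_iff)
    then show "y \<in> cfun.span {\<Psi>}"
      by (auto simp: cfun.span_singleton)
  qed
  then have "cfun.dim (eigenspace q lam) \<le> card {\<Psi>}"
    by (rule cfun.dim_le_card) simp
  then show ?thesis by (simp add: geometric_multiplicity_def)
qed

lemma two_eigenfunctions: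
  assumes "geometric_multiplicity q lam = 2"
  obtains \<Phi> \<Psi> where "eigenfunction q lam \<Phi>" "eigenfunction q lam \<Psi>" "\<Phi> \<noteq> \<Psi>" "cfun.independent {\<Phi>, \<Psi>}"
    "has_form (- int n) \<Phi>" "has_form (int n) \<Psi>"
proof -
  obtain \<Psi> where \<Psi>: "eigenfunction q lam \<Psi>" "has_form (int n) \<Psi>"
    "ip01 \<Psi> (expi (- int n)) = 0" "ip01 \<Psi> (expi (int n)) = 1"
    by (rule upper_eigenfunction)
  obtain y where "y \<in> eigenspace q lam" "ip01 y (expi (- int n)) \<noteq> 0"
    using geometric_multiplicity_le_1 assms by fastforce
  then obtain \<Phi> where \<Phi>: "eigenfunction q lam \<Phi>" "has_form (- int n) \<Phi>" "ip01 \<Phi> (expi (- int n)) = 1"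
    by (rule lower_eigenfunction)
  show thesis
    using that[OF \<Phi>(1) \<Psi>(1) _ _ \<Phi>(2) \<Psi>(2)] independent_by_coefficients[OF \<Phi>(3) \<Psi>(3,4)] by blast
qed

text \<open>An eigenfunction with a nonzero coefficient at \<open>-n\<close> would be independent of the upper eigenfunction,
and the eigenspace at least two-dimensional.\<close>

lemma eigenspace_coeff_below_of_multiplicity_1:
  assumes "geometric_multiplicity q lam = 1" "y \<in> eigenspace q lam"
  shows "ip01 y (expi (- int n)) = 0"
proof (rule ccontr)
  assume "ip01 y (expi (- int n)) \<noteq> 0"
  with assms(2) obtain \<Phi> where \<Phi>: "eigenfunction q lam \<Phi>" "ip01 \<Phi> (expi (- int n)) = 1"
    by (rule lower_eigenfunction)
  obtain \<Psi> where \<Psi>: "eigenfunction q lam \<Psi>" "ip01 \<Psi> (expi (- int n)) = 0" "ip01 \<Psi> (expi (int n)) = 1"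
    by (rule upper_eigenfunction)
  note ind = independent_by_coefficients[OF \<Phi>(2) \<Psi>(2,3)]
  obtain B where B: "eigenspace q lam \<subseteq> cfun.span B" "card B = 1"
    using cfun.basis_exists[of "eigenspace q lam"] assms(1)
    unfolding geometric_multiplicity_def by metis
  have "finite B" using B(2) by (simp add: card_ge_0_finite)
  moreover have "{\<Phi>, \<Psi>} \<subseteq> cfun.span B"
    using B(1) \<Phi>(1) \<Psi>(1) by (auto simp: eigenfunction_def)
  ultimately have "card {\<Phi>, \<Psi>} \<le> card B"
    using cfun.independent_span_bound[OF _ ind(2)] by blast
  then show False using ind(1) B(2) by simp
qed

text \<open>For geometric multiplicity one the defect \<open>c\<close> cannot vanish: otherwise the chain would give an
eigenfunction with coefficient 1 at \<open>-n\<close>.\<close>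

lemma eigenfunction_with_associated_function:
  assumes "geometric_multiplicity q lam = 1"
  obtains \<Psi> \<Phi> c where "eigenfunction q lam \<Psi>" "has_form (int n) \<Psi>" "has_form (- int n) \<Phi>" "c \<noteq> 0"
    "associated_function q lam (\<lambda>x. c * \<Psi> x) \<Phi>"
proof -
  obtain \<psi> where \<psi>: "\<And>j. j < int n \<Longrightarrow> \<psi> j = 0" "\<psi> (int n) = 1" "(\<lambda>j. norm (\<psi> j)) summable_on UNIV"
    "\<And>k. int n \<le> k \<Longrightarrow> symb k * \<psi> k + (\<Sum>j\<in>{int n..<k}. Q (k - j) * \<psi> j) = 0"
    by (rule upper_eigenfunction_coefficients) blast
  obtain \<phi> c where \<phi>: "\<forall>j. j < - int n \<longrightarrow> \<phi> j = 0" "\<phi> (- int n) = 1"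
    "(\<lambda>j. norm (\<phi> j)) summable_on UNIV"
    "\<forall>k. - int n \<le> k \<longrightarrow> symb k * \<phi> k + (\<Sum>j\<in>{- int n..<k}. Q (k - j) * \<phi> j) = c * \<psi> k"
    using \<psi>(1-3) by (rule lower_chain_coefficients)
  have low: "\<phi> j = 0" if "j < - int n" for j
    using \<phi>(1) that by blast
  let ?\<Psi> = "trig_extension \<psi>" and ?\<Phi> = "trig_extension \<phi>"
  have \<Psi>E: "?\<Psi> \<in> eigenspace q lam"
    by (rule eigenspace_recurrenceI[OF \<psi>(3,1,4)])
  have \<Psi>n: "ip01 ?\<Psi> (expi (int n)) = 1"
    using \<psi>(2) by (simp add: fourier_coefficients_trig_extension[OF \<psi>(3)])
  have c: "c \<noteq> 0"
  proof
    assume "c = 0"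
    then have "?\<Phi> \<in> eigenspace q lam"
      using \<phi>(4) by (intro eigenspace_recurrenceI[OF \<phi>(3) low]) auto
    then have "ip01 ?\<Phi> (expi (- int n)) = 0"
      by (rule eigenspace_coeff_below_of_multiplicity_1[OF assms])
    then show False
      using \<phi>(2) by (simp add: fourier_coefficients_trig_extension[OF \<phi>(3)])
  qed
  have c\<psi>: "trig_extension (\<lambda>k. c * \<psi> k) x = c * ?\<Psi> x" for x
    by (simp add: trig_extension_def trig_series_def mult.assoc infsum_cmult_right')
  have "L0 q ?\<Phi> (\<lambda>x. lam * ?\<Phi> x + trig_extension (\<lambda>k. c * \<psi> k) x)"
  proof (rule L0_of_recurrence[OF \<phi>(3) low])
    show "(\<lambda>j. norm (c * \<psi> j)) summable_on UNIV"
      using \<psi>(3) by (simp add: norm_mult summable_on_cmult_right)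
    show "c * \<psi> j = 0" if "j < - int n" for j
      using \<psi>(1)[of j] that by simp
  qed (use \<phi>(4) in auto)
  then have L0\<Phi>: "L0 q ?\<Phi> (\<lambda>x. lam * ?\<Phi> x + c * ?\<Psi> x)"
    by (simp only: c\<psi>)
  have nonzero: "?\<Psi> \<noteq> (\<lambda>x. 0)"
    using \<Psi>n by (auto simp: ip01_eq)
  have "eigenfunction q lam ?\<Psi>"
    using \<Psi>E nonzero by (simp add: eigenfunction_def)
  moreover have "associated_function q lam (\<lambda>x. c * ?\<Psi> x) ?\<Phi>"
    unfolding associated_function_def
  proof (intro conjI exI)
    have "(\<lambda>x. c * ?\<Psi> x) \<in> eigenspace q lam"
      using eigenspace_lincomb[OF q_integrable \<Psi>E \<Psi>E, of c 0] by simp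
    moreover have "(\<lambda>x. c * ?\<Psi> x) \<noteq> (\<lambda>x. 0)"
      using nonzero c by (simp add: fun_eq_iff)
    ultimately show "eigenfunction q lam (\<lambda>x. c * ?\<Psi> x)"
      by (simp add: eigenfunction_def)
    show "L0 q ?\<Phi> (\<lambda>x. lam * ?\<Phi> x + c * ?\<Psi> x)" by fact
  qed simp
  ultimately show thesis
    using trig_extension_has_form[OF \<psi>(3,1,2)] trig_extension_has_form[OF \<phi>(3) low \<phi>(2)] c
    by (intro that[of ?\<Psi> ?\<Phi> c])
qed

end

theorem theorem9:
  fixes q :: "real \<Rightarrow> complex" and n :: nat
  assumes "q absolutely_integrable_on {0..1}"
    and "\<And>x. q (x + 1) = q x"
    and "\<And>k::int. k \<le> 0 \<Longrightarrow> ip01 q (expi k) = 0"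
    and "n \<ge> 1"
  shows
    "(\<forall>\<Psi>. \<Psi> \<in> eigenspace q (complex_of_real ((2 * pi * real n)\<^sup>2)) \<longrightarrow>
        (ip01 \<Psi> (expi (- int n)) \<noteq> 0 \<longrightarrow>
           has_form_up_to_constant (- int n) \<Psi>) \<and>
        (ip01 \<Psi> (expi (- int n)) = 0 \<and> ip01 \<Psi> (expi (int n)) \<noteq> 0 \<longrightarrow>
           has_form_up_to_constant (int n) \<Psi>) \<and>
        (ip01 \<Psi> (expi (- int n)) = 0 \<and> ip01 \<Psi> (expi (int n)) = 0 \<longrightarrow>
           \<Psi> = (\<lambda>x. 0)))
     \<and>
     (geometric_multiplicity q (complex_of_real ((2 * pi * real n)\<^sup>2)) = 2 \<longrightarrow>
        (\<exists>\<Psi>m \<Psi>n.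
           eigenfunction q (complex_of_real ((2 * pi * real n)\<^sup>2)) \<Psi>m \<and>
           eigenfunction q (complex_of_real ((2 * pi * real n)\<^sup>2)) \<Psi>n \<and>
           \<Psi>m \<noteq> \<Psi>n \<and> cfun.independent {\<Psi>m, \<Psi>n} \<and>
           has_form (- int n) \<Psi>m \<and> has_form (int n) \<Psi>n))
     \<and>
     (geometric_multiplicity q (complex_of_real ((2 * pi * real n)\<^sup>2)) = 1 \<longrightarrow>
        (\<exists>\<Psi> \<Phi> c.
           eigenfunction q (complex_of_real ((2 * pi * real n)\<^sup>2)) \<Psi> \<and>
           has_form (int n) \<Psi> \<and>
           has_form (- int n) \<Phi> \<and>
           c \<noteq> 0 \<and>
           associated_function q (complex_of_real ((2 * pi * real n)\<^sup>2)) (\<lambda>x. c * \<Psi> x) \<Phi>))"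
proof -
  interpret one_sided_potential q n
    using assms by unfold_locales (auto simp: absolutely_integrable_01_iff)
  show ?thesis
    unfolding lam_def[symmetric]
  proof (intro conjI allI impI)
    fix \<Psi> assume \<Psi>: "\<Psi> \<in> eigenspace q lam"
    show "has_form_up_to_constant (- int n) \<Psi>" if "ip01 \<Psi> (expi (- int n)) \<noteq> 0"
      using that by (rule eigenfunction_form(1)[OF \<Psi>])
    show "has_form_up_to_constant (int n) \<Psi>"
      if "ip01 \<Psi> (expi (- int n)) = 0 \<and> ip01 \<Psi> (expi (int n)) \<noteq> 0"
      using that by (elim conjE) (rule eigenfunction_form(2)[OF \<Psi>])
    show "\<Psi> = (\<lambda>x. 0)" if "ip01 \<Psi> (expi (- int n)) = 0 \<and> ip01 \<Psi> (expi (int n)) = 0"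
      using that by (elim conjE) (rule eigenfunction_form(3)[OF \<Psi>])
  next
    assume "geometric_multiplicity q lam = 2"
    then show "\<exists>\<Psi>m \<Psi>n. eigenfunction q lam \<Psi>m \<and> eigenfunction q lam \<Psi>n \<and> \<Psi>m \<noteq> \<Psi>n \<and>
        cfun.independent {\<Psi>m, \<Psi>n} \<and> has_form (- int n) \<Psi>m \<and> has_form (int n) \<Psi>n"
      by (rule two_eigenfunctions) blast
  next
    assume "geometric_multiplicity q lam = 1"
    then show "\<exists>\<Psi> \<Phi> c. eigenfunction q lam \<Psi> \<and> has_form (int n) \<Psi> \<and> has_form (- int n) \<Phi> \<and> c \<noteq> 0 \<and>
        associated_function q lam (\<lambda>x. c * \<Psi> x) \<Phi>"
      by (rule eigenfunction_with_associated_function) blast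
  qed
qed

end
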